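(* Let $d\ge 1$, $p>0$, and let $f\in L^q(\mathbb{R}^d)$, for some $q>d/2$ (with $q\ge1$), be a nonnegative function with compact support. Then every solution $u_p$ of the problem $$\min\left\{\frac12\int_{\mathbb{R}^d}|\nabla u|^2\,dx+\frac12\left(\int_{\mathbb{R}^d}|u|^{2p/(p+1)}\,dx\right)^{(p+1)/p}-\int_{\mathbb{R}^d}uf\,dx\ :\ u\in\dot{H}^1(\mathbb{R}^d),\ |u|^{2p/(p+1)}\in L^1(\mathbb{R}^d)\right\}$$ has compact support.
   Context: $\dot{H}^1(\mathbb{R}^d)$ is the closure of $C^\infty_c(\mathbb{R}^d)$ with respect to the $L^2$ norm of the gradient. *)

theory Defs
  imports "HOL-Analysis.Analysis"
begin

text \<open>
  Functions on \<open>\<real>\<^sup>d\<close> are functions on a type of class \<^class>\<open>euclidean_space\<close>, with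
  \<open>d = DIM('a)\<close>. They represent classes modulo equality almost everywhere; every
  notion below that is applied to a non-smooth function is invariant under changes on null sets.
\<close>

text \<open>Smoothness means being of class \<open>C\<^sup>k\<close> for all \<open>k\<close>, by recursion over directional derivatives.\<close>

primrec Ck :: "nat \<Rightarrow> ('a::euclidean_space \<Rightarrow> real) \<Rightarrow> bool" where
  "Ck 0 f \<longleftrightarrow> continuous_on UNIV f"
| "Ck (Suc k) f \<longleftrightarrow>
     (\<forall>x. f differentiable at x) \<and> (\<forall>v. Ck k (\<lambda>x. frechet_derivative f (at x) v))"

definition test_functions :: "('a::euclidean_space \<Rightarrow> real) set" where
  "test_functions = {\<phi>. (\<forall>k. Ck k \<phi>) \<and> compact (closure {x. \<phi> x \<noteq> 0})}"

definition grad :: "('a::euclidean_space \<Rightarrow> real) \<Rightarrow> 'a \<Rightarrow> 'a" where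
  "grad \<phi> x = (\<Sum>b\<in>Basis. frechet_derivative \<phi> (at x) b *\<^sub>R b)"

definition loc_integrable :: "('a::euclidean_space \<Rightarrow> 'b::euclidean_space) \<Rightarrow> bool" where
  "loc_integrable u \<longleftrightarrow> (\<forall>K. compact K \<longrightarrow> set_integrable lebesgue K u)"

definition has_weak_gradient ::
    "('a::euclidean_space \<Rightarrow> real) \<Rightarrow> ('a \<Rightarrow> 'a) \<Rightarrow> bool" where
  "has_weak_gradient u g \<longleftrightarrow> loc_integrable u \<and> loc_integrable g \<and>
     (\<forall>\<phi>\<in>test_functions.
        (\<integral>x. u x *\<^sub>R grad \<phi> x \<partial>lebesgue) = - (\<integral>x. \<phi> x *\<^sub>R g x \<partial>lebesgue))"

text \<open>The choice is immaterial: a weak gradient is unique up to null sets.\<close>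

definition weak_grad :: "('a::euclidean_space \<Rightarrow> real) \<Rightarrow> 'a \<Rightarrow> 'a" where
  "weak_grad u = (SOME g. has_weak_gradient u g)"

text \<open>
  The closure of the test functions with respect to the \<open>L\<^sup>2\<close> norm of the gradient. On functions
  this is only a seminorm, so the closure is realised inside the locally integrable functions:
  the approximating sequence also converges to \<open>u\<close> in \<open>L\<^sup>1\<close> on compact sets. For \<open>d \<ge> 3\<close> this is
  the usual space of functions, without the nonzero constants. For \<open>d \<le> 2\<close>, where the abstract
  completion consists of classes modulo constants, it contains all representatives of these classes.
\<close>

definition H1_dot :: "('a::euclidean_space \<Rightarrow> real) set" where
  "H1_dot = {u. (\<exists>g. has_weak_gradient u g) \<and>
     integrable lebesgue (\<lambda>x. (norm (weak_grad u x))\<^sup>2) \<and>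
     (\<exists>\<phi>. (\<forall>n. \<phi> n \<in> test_functions) \<and>
        (\<lambda>n. \<integral>x. (norm (weak_grad u x - grad (\<phi> n) x))\<^sup>2 \<partial>lebesgue) \<longlonglongrightarrow> 0 \<and>
        (\<forall>K. compact K \<longrightarrow> (\<lambda>n. LINT x:K|lebesgue. \<bar>u x - \<phi> n x\<bar>) \<longlonglongrightarrow> 0))}"

definition Lq :: "ereal \<Rightarrow> ('a::euclidean_space \<Rightarrow> real) set" where
  "Lq q = {f \<in> borel_measurable lebesgue.
     if q = \<infinity> then \<exists>C. AE x in lebesgue. \<bar>f x\<bar> \<le> C
     else integrable lebesgue (\<lambda>x. \<bar>f x\<bar> powr real_of_ereal q)}"

definition ess_support :: "('a::euclidean_space \<Rightarrow> real) \<Rightarrow> 'a set" where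
  "ess_support u = - \<Union>{U. open U \<and> (AE x in lebesgue. x \<in> U \<longrightarrow> u x = 0)}"

definition has_compact_support :: "('a::euclidean_space \<Rightarrow> real) \<Rightarrow> bool" where
  "has_compact_support u \<longleftrightarrow> compact (ess_support u)"

definition admissible :: "real \<Rightarrow> ('a::euclidean_space \<Rightarrow> real) \<Rightarrow> bool" where
  "admissible p u \<longleftrightarrow> u \<in> H1_dot \<and> integrable lebesgue (\<lambda>x. \<bar>u x\<bar> powr (2 * p / (p + 1)))"

definition energy ::
    "real \<Rightarrow> ('a::euclidean_space \<Rightarrow> real) \<Rightarrow> ('a \<Rightarrow> real) \<Rightarrow> real" where
  "energy p f u =
     1/2 * (\<integral>x. (norm (weak_grad u x))\<^sup>2 \<partial>lebesgue)
     + 1/2 * (\<integral>x. \<bar>u x\<bar> powr (2 * p / (p + 1)) \<partial>lebesgue) powr ((p + 1) / p)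
     - (\<integral>x. u x * f x \<partial>lebesgue)"

end

theory Submission
  imports Defs
begin

text \<open>
  The lower order term of the energy has exponent \<open>r = 2p/(p+1) < 2\<close>, so for small values of \<open>u\<close> it
  dominates the quadratic terms. The proof measures this by the energy in the exterior of balls,
  \<open>T(\<rho>) = \<integral> \<bar>\<nabla>u\<bar>\<^sup>2 + c \<bar>u\<bar>\<^sup>r\<close> over \<open>\<bar>x\<bar> \<ge> \<rho>\<close>, and shows that \<open>T\<close> vanishes at a finite radius.

  Let \<open>\<eta>\<close> be a cut-off function that descends from one to zero between the radii \<open>\<rho>\<close> and
  \<open>\<rho> + \<delta>\<close>. If \<open>f\<close> vanishes outside the ball of radius \<open>\<rho>\<close>, then \<open>u\<close> and \<open>\<eta> u\<close> have the same
  integral against \<open>f\<close>, and minimality of \<open>u\<close> (\<open>minimizer_cutoff_inequality\<close>) together with the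
  convexity of \<open>x\<^bsup>(p+1)/p\<^esup>\<close> yields
  \<open>2 T(\<rho> + \<delta>) \<le> T(\<rho>) + 2 (L/\<delta>)\<^sup>2 \<integral> u\<^sup>2\<close>, the integral extending over the shell between the radii.
  The square integral over the shell is controlled by the interpolation inequality
  \<open>gradient_limit_interpolation\<close>: up to a small multiple of \<open>\<delta>\<^sup>2 T\<close> it is of order
  \<open>\<delta>\<^bsup>-ds\<^esup> T\<^bsup>1+s\<^esup>\<close> with \<open>s = 1/p > 0\<close>. Hence
  \<open>T(\<rho> + 2\<delta>) \<le> 3/4 T(\<rho>) + K \<delta>\<^bsup>-m\<^esup> T(\<rho>)\<^bsup>1+s\<^esup>\<close>, and because the exponent \<open>1 + s\<close> exceeds one, the step
  widths may be chosen summable while \<open>T\<close> decays geometrically (\<open>decay_iteration\<close>).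

  The interpolation inequality is derived from the translation estimate
  \<open>\<integral> \<bar>u(x+z) - u(x)\<bar>\<^sup>2 \<le> C \<bar>z\<bar>\<^sup>2 \<integral> \<bar>\<nabla>u\<bar>\<^sup>2\<close> by averaging over \<open>z\<close> in a small ball: where \<open>\<bar>u\<bar>\<close> is large
  compared with its local mean, most of its translates are much smaller, so the increments
  control \<open>u\<close>. The same inequality with \<open>r = 1\<close> shows that the test functions approximating \<open>u\<close>
  converge locally in \<open>L\<^sup>2\<close>, and therefore that \<open>\<eta> u\<close> is an admissible competitor
  (\<open>H1_dot_product\<close>). Its energy refers to a chosen weak gradient; by the fundamental lemma of the
  calculus of variations this agrees almost everywhere with the one given by the product rule.
\<close>

section \<open>Smooth cut-off functions\<close>

lemma has_derivative_Ck:
  assumes "Ck (Suc k) f"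
  shows "(f has_derivative frechet_derivative f (at x)) (at x)"
  using assms frechet_derivative_works by auto

lemma Ck_SucI:
  assumes "\<And>x. (f has_derivative f' x) (at x)" and "\<And>v. Ck k (\<lambda>x. f' x v)"
  shows "Ck (Suc k) f"
proof -
  have "frechet_derivative f (at x) = f' x" for x
    using frechet_derivative_at[OF assms(1)] by simp
  then show ?thesis using assms by (auto simp: differentiable_def)
qed

lemma Ck_Suc_imp_Ck: "Ck (Suc k) f \<Longrightarrow> Ck k f"
proof (induction k arbitrary: f)
  case 0
  then show ?case
    by (auto simp: continuous_on_eq_continuous_at differentiable_imp_continuous_within)
qed auto

lemma Ck_const: "Ck k (\<lambda>x. c)"
proof (induction k arbitrary: c)
  case (Suc k)
  show ?case by (rule Ck_SucI[of _ "\<lambda>x v. 0"]) (auto intro: Suc.IH)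
qed auto

lemma Ck_inner: "Ck k (\<lambda>x. x \<bullet> v)"
proof (cases k)
  case (Suc k)
  show ?thesis unfolding Suc
    by (rule Ck_SucI[of _ "\<lambda>x w. w \<bullet> v"]) (auto intro!: Ck_const derivative_eq_intros)
qed (auto intro!: continuous_intros)

lemma Ck_add: "Ck k f \<Longrightarrow> Ck k g \<Longrightarrow> Ck k (\<lambda>x. f x + g x)"
proof (induction k arbitrary: f g)
  case 0
  then show ?case by (auto intro: continuous_intros)
next
  case (Suc k)
  show ?case
    by (rule Ck_SucI[where f' = "\<lambda>x v. frechet_derivative f (at x) v + frechet_derivative g (at x) v"])
       (use Suc in \<open>auto intro!: derivative_eq_intros has_derivative_Ck\<close>)
qed

lemma Ck_mult: "Ck k f \<Longrightarrow> Ck k g \<Longrightarrow> Ck k (\<lambda>x. f x * g x)"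
proof (induction k arbitrary: f g)
  case 0
  then show ?case by (auto intro: continuous_intros)
next
  case (Suc k)
  have "Ck k (\<lambda>x. f x * frechet_derivative g (at x) v + frechet_derivative f (at x) v * g x)" for v
    using Suc.prems Ck_Suc_imp_Ck[OF Suc.prems(1)] Ck_Suc_imp_Ck[OF Suc.prems(2)]
    by (intro Ck_add Suc.IH) auto
  then show ?case
    by (intro Ck_SucI[where f' = "\<lambda>x v. f x * frechet_derivative g (at x) v
          + frechet_derivative f (at x) v * g x"])
       (use Suc.prems in \<open>auto intro!: derivative_eq_intros has_derivative_Ck\<close>)
qed

lemma Ck_minus: "Ck k f \<Longrightarrow> Ck k (\<lambda>x. - f x)"
  using Ck_mult[OF Ck_const[of k "-1"], of f] by simp

lemma Ck_diff: "Ck k f \<Longrightarrow> Ck k g \<Longrightarrow> Ck k (\<lambda>x. f x - g x)"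
  using Ck_add[OF _ Ck_minus, of k f g] by simp

lemma Ck_sum: "finite I \<Longrightarrow> (\<And>i. i \<in> I \<Longrightarrow> Ck k (f i)) \<Longrightarrow> Ck k (\<lambda>x. \<Sum>i\<in>I. f i x)"
  by (induction I rule: finite_induct) (auto intro: Ck_const Ck_add)

lemma Ck_prod: "finite I \<Longrightarrow> (\<And>i. i \<in> I \<Longrightarrow> Ck k (f i)) \<Longrightarrow> Ck k (\<lambda>x. \<Prod>i\<in>I. f i x)"
  by (induction I rule: finite_induct) (auto intro: Ck_const Ck_mult)

text \<open>The whole sequence of derivatives of the outer function has to be carried along, because
  differentiating \<open>H j \<circ> f\<close> produces \<open>H (Suc j) \<circ> f\<close>.\<close>

lemma Ck_compose:
  fixes H :: "nat \<Rightarrow> real \<Rightarrow> real"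
  assumes H: "\<And>j t. (H j has_real_derivative H (Suc j) t) (at t)"
  shows "Ck k f \<Longrightarrow> Ck k (\<lambda>x. H j (f x))"
proof (induction k arbitrary: f j)
  case 0
  have "continuous_on UNIV (H j)"
    using H by (auto simp: continuous_on_eq_continuous_at intro: DERIV_isCont)
  with 0 show ?case by (auto intro: continuous_on_compose2)
next
  case (Suc k)
  have "Ck k (\<lambda>x. frechet_derivative f (at x) v * H (Suc j) (f x))" for v
    using Suc.prems Ck_Suc_imp_Ck[OF Suc.prems] by (intro Ck_mult Suc.IH) auto
  moreover have "((\<lambda>x. H j (f x)) has_derivative
      (\<lambda>v. frechet_derivative f (at x) v * H (Suc j) (f x))) (at x)" for x
    by (rule DERIV_compose_FDERIV[OF H has_derivative_Ck[OF Suc.prems]])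
  ultimately show ?case by (intro Ck_SucI)
qed

text \<open>The family of functions \<open>P(1/t) exp(-1/t)\<close>, extended by zero to \<open>t \<le> 0\<close>, is closed under
  differentiation; this makes \<open>exp(-1/t)\<close> smooth across the origin.\<close>

definition flat :: "real poly \<Rightarrow> real \<Rightarrow> real" where
  "flat P t = (if t > 0 then poly P (1 / t) * exp (- (1 / t)) else 0)"

lemma poly_div_exp_tendsto_0: "((\<lambda>s::real. poly P s / exp s) \<longlongrightarrow> 0) at_top"
proof -
  have "((\<lambda>s. \<Sum>i\<le>degree P. coeff P i * (s ^ i / exp s)) \<longlongrightarrow> (\<Sum>i\<le>degree P. coeff P i * 0)) at_top"
    by (intro tendsto_intros tendsto_power_div_exp_0)
  then show ?thesis by (simp add: poly_altdef sum_divide_distrib)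
qed

lemma flat_has_derivative:
  "(flat P has_real_derivative flat ([:0, 0, 1:] * (P - pderiv P)) t) (at t)"
proof -
  consider "t > 0" | "t < 0" | "t = 0" by linarith
  then show ?thesis
  proof cases
    case 1
    have "((\<lambda>t. poly P (1 / t) * exp (- (1 / t))) has_real_derivative
        flat ([:0, 0, 1:] * (P - pderiv P)) t) (at t)"
      using 1 by (auto intro!: derivative_eq_intros DERIV_chain'[where g = "poly P"] poly_DERIV
          simp: flat_def power2_eq_square field_simps)
    moreover have "eventually (\<lambda>t. flat P t = poly P (1 / t) * exp (- (1 / t))) (nhds t)"
      using eventually_nhds_in_open[of "{0<..}" t] 1 by (auto simp: flat_def elim: eventually_mono)
    ultimately show ?thesis by (subst DERIV_cong_ev[OF refl _ refl]) auto
  next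
    case 2
    have "((\<lambda>t. 0) has_real_derivative 0) (at t)" by simp
    moreover have "eventually (\<lambda>t. flat P t = 0) (nhds t)"
      using eventually_nhds_in_open[of "{..<0}" t] 2 by (auto simp: flat_def elim: eventually_mono)
    ultimately show ?thesis using 2
      by (subst DERIV_cong_ev[OF refl _ refl]) (auto simp: flat_def)
  next
    case 3
    have "((\<lambda>h. flat P h / h) \<longlongrightarrow> 0) (at_left 0)"
      by (rule tendsto_eventually) (auto simp: flat_def eventually_at_filter)
    moreover have "((\<lambda>h. flat P h / h) \<longlongrightarrow> 0) (at_right 0)"
    proof -
      have "((\<lambda>t. poly ([:0, 1:] * P) (inverse t) / exp (inverse t)) \<longlongrightarrow> 0) (at_right 0)"
        by (rule filterlim_compose[OF poly_div_exp_tendsto_0 filterlim_inverse_at_top_right])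
      then show ?thesis
        by (rule Lim_transform_eventually)
           (auto simp: flat_def eventually_at_filter exp_minus field_simps)
    qed
    ultimately have "((\<lambda>h. flat P h / h) \<longlongrightarrow> 0) (at 0)" by (rule filterlim_split_at)
    then show ?thesis using 3 by (simp add: has_field_derivative_iff flat_def)
  qed
qed

primrec flat_poly :: "nat \<Rightarrow> real poly" where
  "flat_poly 0 = 1"
| "flat_poly (Suc j) = [:0, 0, 1:] * (flat_poly j - pderiv (flat_poly j))"

lemma Ck_flat: "Ck k f \<Longrightarrow> Ck k (\<lambda>x. flat 1 (f x))"
  using Ck_compose[of "\<lambda>j. flat (flat_poly j)" k f 0] flat_has_derivative by simp

lemma flat_1_pos_iff: "flat 1 t > 0 \<longleftrightarrow> t > 0"
  by (simp add: flat_def)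

lemma flat_1_mono: "s \<le> t \<Longrightarrow> flat 1 s \<le> flat 1 t"
  by (auto simp: flat_def frac_le)

text \<open>A smooth step that descends from one on \<open>t \<le> 0\<close> to zero on \<open>t \<ge> 1\<close>. Both plateaus come
  from the one plateau of \<open>flat 1\<close>.\<close>

definition smooth_step :: "real \<Rightarrow> real" where
  "smooth_step t = flat 1 (flat 1 1 - flat 1 t) / flat 1 (flat 1 1)"

lemma smooth_step_bounds: "0 \<le> smooth_step t" "smooth_step t \<le> 1"
proof -
  have "flat 1 (flat 1 1) > 0" by (simp add: flat_1_pos_iff)
  moreover have "flat 1 s \<ge> 0" for s by (simp add: flat_def)
  moreover have "flat 1 (flat 1 1 - flat 1 t) \<le> flat 1 (flat 1 1)"
    by (rule flat_1_mono) (simp add: flat_def)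
  ultimately show "0 \<le> smooth_step t" "smooth_step t \<le> 1" by (auto simp: smooth_step_def)
qed

lemma smooth_step_eq_1: "t \<le> 0 \<Longrightarrow> smooth_step t = 1"
  using flat_1_pos_iff[of "flat 1 1"] flat_1_pos_iff[of 1] by (simp add: smooth_step_def flat_def)

lemma smooth_step_eq_0: "t \<ge> 1 \<Longrightarrow> smooth_step t = 0"
  using flat_1_mono[of 1 t] flat_1_pos_iff[of "flat 1 1 - flat 1 t"]
  by (simp add: smooth_step_def flat_def)

lemma Ck_smooth_step: "Ck k f \<Longrightarrow> Ck k (\<lambda>x. smooth_step (f x))"
  using Ck_mult[OF Ck_flat[OF Ck_diff[OF Ck_const Ck_flat]] Ck_const, of k f "flat 1 1"
      "inverse (flat 1 (flat 1 1))"]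
  by (simp add: smooth_step_def divide_inverse)

lemma smooth_step_derivative:
  obtains S' L where "L > 0" "\<And>t. (smooth_step has_real_derivative S' t) (at t)"
    "\<And>t. \<bar>S' t\<bar> \<le> L" "\<And>t. t \<le> 0 \<or> t \<ge> 1 \<Longrightarrow> S' t = 0"
proof
  define F' where "F' = flat [:0, 0, 1:]"
  define c where "c = flat 1 (flat 1 1)"
  have c: "c > 0" by (simp add: c_def flat_1_pos_iff)
  have F': "(flat 1 has_real_derivative F' t) (at t)" for t
    using flat_has_derivative[of 1 t] by (simp add: F'_def)
  have bound: "\<bar>F' t\<bar> \<le> 2" for t
  proof (cases "t > 0")
    case True
    have "1 + 1/t + (1/t)\<^sup>2 / 2 \<le> exp (1/t)"
      using exp_lower_Taylor_quadratic[of "1/t"] True by simp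
    then have "(1/t)\<^sup>2 \<le> 2 * exp (1/t)"
      using True by (smt (verit) divide_pos_pos field_sum_of_halves)
    then show ?thesis using True
      by (simp add: F'_def flat_def exp_minus field_simps power2_eq_square)
  qed (simp add: F'_def flat_def)
  let ?S' = "\<lambda>t. - (F' (flat 1 1 - flat 1 t) * F' t) / c"
  show "4 / c > 0" using c by simp
  show "(smooth_step has_real_derivative ?S' t) (at t)" for t
    unfolding smooth_step_def c_def[symmetric]
    by (rule derivative_eq_intros DERIV_chain'[where g = "flat 1", OF _ F'] F' refl)+ (use c in simp_all)
  show "\<bar>?S' t\<bar> \<le> 4 / c" for t
    using mult_mono[OF bound[of "flat 1 1 - flat 1 t"] bound[of t]] c
    by (simp add: abs_mult divide_right_mono)
  show "?S' t = 0" if "t \<le> 0 \<or> t \<ge> 1" for t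
    using that flat_1_mono[of 1 t] by (auto simp: F'_def flat_def)
qed

lemma Ck_norm_square: "Ck k (\<lambda>x::'a::euclidean_space. (norm x)\<^sup>2)"
proof -
  have "Ck k (\<lambda>x::'a. \<Sum>b\<in>Basis. (x \<bullet> b) * (x \<bullet> b))"
    by (intro Ck_sum Ck_mult Ck_inner) auto
  then show ?thesis by (simp add: power2_norm_eq_inner euclidean_inner[symmetric])
qed

lemma test_functionsI:
  assumes "\<And>k. Ck k \<phi>" "bounded {x. \<phi> x \<noteq> 0}"
  shows "\<phi> \<in> test_functions"
  using assms by (simp add: test_functions_def compact_closure)

lemma test_functionsD:
  assumes "\<phi> \<in> test_functions"
  shows "Ck k \<phi>" "bounded {x. \<phi> x \<noteq> 0}"
  using assms compact_imp_bounded bounded_closure bounded_subset[OF _ closure_subset]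
  by (auto simp: test_functions_def)

lemma test_function_has_derivative:
  assumes "\<phi> \<in> test_functions"
  shows "(\<phi> has_derivative (\<lambda>v. grad \<phi> x \<bullet> v)) (at x)"
proof -
  have D: "(\<phi> has_derivative frechet_derivative \<phi> (at x)) (at x)"
    using has_derivative_Ck[OF test_functionsD(1)[OF assms, of "Suc 0"]] .
  interpret linear "frechet_derivative \<phi> (at x)"
    using D by (rule has_derivative_linear)
  have "frechet_derivative \<phi> (at x) v = grad \<phi> x \<bullet> v" for v
  proof -
    have "frechet_derivative \<phi> (at x) v = frechet_derivative \<phi> (at x) (\<Sum>b\<in>Basis. (v \<bullet> b) *\<^sub>R b)"
      by (simp add: euclidean_representation)
    also have "\<dots> = grad \<phi> x \<bullet> v"
      by (simp add: sum scaleR grad_def inner_sum_left inner_commute[of v] mult.commute)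
    finally show ?thesis .
  qed
  then show ?thesis using D by (metis (no_types, lifting) ext)
qed

lemma grad_eqI:
  assumes "(\<phi> has_derivative (\<lambda>v. w \<bullet> v)) (at x)"
  shows "grad \<phi> x = w"
proof -
  have "frechet_derivative \<phi> (at x) = (\<lambda>v. w \<bullet> v)"
    using frechet_derivative_at[OF assms] by simp
  then show ?thesis by (simp add: grad_def euclidean_representation)
qed

lemma test_function_mult:
  assumes "\<phi> \<in> test_functions" "\<psi> \<in> test_functions"
  shows "(\<lambda>x. \<phi> x * \<psi> x) \<in> test_functions"
    and "grad (\<lambda>x. \<phi> x * \<psi> x) x = \<phi> x *\<^sub>R grad \<psi> x + \<psi> x *\<^sub>R grad \<phi> x"
proof -
  show "(\<lambda>x. \<phi> x * \<psi> x) \<in> test_functions"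
    by (rule test_functionsI, intro Ck_mult test_functionsD(1) assms)
       (rule bounded_subset[OF test_functionsD(2)[OF assms(1)]], auto)
  show "grad (\<lambda>x. \<phi> x * \<psi> x) x = \<phi> x *\<^sub>R grad \<psi> x + \<psi> x *\<^sub>R grad \<phi> x"
    using has_derivative_mult[OF assms[THEN test_function_has_derivative]]
    by (intro grad_eqI) (simp add: inner_simps mult.commute)
qed

lemma test_function_diff:
  assumes "\<phi> \<in> test_functions" "\<psi> \<in> test_functions"
  shows "(\<lambda>x. \<phi> x - \<psi> x) \<in> test_functions"
    and "grad (\<lambda>x. \<phi> x - \<psi> x) x = grad \<phi> x - grad \<psi> x"
proof -
  show "(\<lambda>x. \<phi> x - \<psi> x) \<in> test_functions"
    by (rule test_functionsI, intro Ck_diff test_functionsD(1) assms)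
       (rule bounded_subset[OF bounded_Un[THEN iffD2, OF conjI[OF test_functionsD(2)[OF assms(1)]
              test_functionsD(2)[OF assms(2)]]]], auto)
  show "grad (\<lambda>x. \<phi> x - \<psi> x) x = grad \<phi> x - grad \<psi> x"
    using has_derivative_diff[OF assms[THEN test_function_has_derivative]]
    by (intro grad_eqI) (simp add: inner_simps)
qed

lemma test_function_continuous:
  assumes "\<phi> \<in> test_functions"
  shows "continuous_on UNIV \<phi>" and "continuous_on UNIV (grad \<phi>)"
proof -
  show "continuous_on UNIV \<phi>" using test_functionsD(1)[OF assms, of 0] by simp
  have "continuous_on UNIV (\<lambda>x. frechet_derivative \<phi> (at x) v)" for v
    using test_functionsD(1)[OF assms, of "Suc 0"] by simp
  then show "continuous_on UNIV (grad \<phi>)"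
    unfolding grad_def[abs_def] by (intro continuous_intros)
qed

lemma test_function_measurable:
  assumes "\<phi> \<in> test_functions"
  shows "\<phi> \<in> borel_measurable borel" and "grad \<phi> \<in> borel_measurable borel"
  using test_function_continuous[OF assms] by (auto intro: borel_measurable_continuous_onI)

lemma grad_eq_0_outside:
  assumes "\<phi> \<in> test_functions" "x \<notin> closure {x. \<phi> x \<noteq> 0}"
  shows "grad \<phi> x = 0"
proof (rule grad_eqI)
  let ?U = "- closure {x. \<phi> x \<noteq> 0}"
  have 1: "open ?U" and 2: "x \<in> ?U" using assms(2) by auto
  have 3: "0 = \<phi> y" if "y \<in> ?U" for y
    using closure_subset[of "{x. \<phi> x \<noteq> 0}"] that by (metis (mono_tags, lifting) ComplD mem_Collect_eq subsetD)
  have "(\<phi> has_derivative (\<lambda>v. 0)) (at x)"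
    by (rule has_derivative_transform_within_open[OF has_derivative_const 1 2 3])
  then show "(\<phi> has_derivative (\<lambda>v. 0 \<bullet> v)) (at x)" by simp
qed

lemma test_function_bounded:
  assumes "\<phi> \<in> test_functions"
  obtains C where "C > 0" "\<And>x. \<bar>\<phi> x\<bar> \<le> C" "\<And>x. norm (grad \<phi> x) \<le> C"
proof -
  let ?K = "closure {x. \<phi> x \<noteq> 0}"
  have K: "compact ?K" using assms by (simp add: test_functions_def)
  have "bounded (\<phi> ` ?K)" "bounded (grad \<phi> ` ?K)"
    using test_function_continuous[OF assms] K
    by (meson compact_continuous_image compact_imp_bounded continuous_on_subset subset_UNIV)+
  then obtain A B where A: "A > 0" "\<And>x. x \<in> ?K \<Longrightarrow> \<bar>\<phi> x\<bar> \<le> A"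
    and B: "B > 0" "\<And>x. x \<in> ?K \<Longrightarrow> norm (grad \<phi> x) \<le> B"
    unfolding bounded_pos by fastforce
  have "\<bar>\<phi> x\<bar> \<le> A + B \<and> norm (grad \<phi> x) \<le> A + B" for x
  proof (cases "x \<in> ?K")
    case True
    then show ?thesis using A B by fastforce
  next
    case False
    then have "\<phi> x = 0" using closure_subset[of "{x. \<phi> x \<noteq> 0}"] by auto
    then show ?thesis using grad_eq_0_outside[OF assms False] A B by simp
  qed
  then show thesis using that[of "A + B"] A(1) B(1) by simp
qed

definition radial_cutoff :: "real \<Rightarrow> real \<Rightarrow> real \<Rightarrow> ('a::euclidean_space \<Rightarrow> real) \<Rightarrow> bool" where
  "radial_cutoff L \<rho> \<delta> \<eta> \<longleftrightarrow> \<eta> \<in> test_functions \<and> (\<forall>x. 0 \<le> \<eta> x \<and> \<eta> x \<le> 1 \<and>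
     (norm x \<le> \<rho> \<longrightarrow> \<eta> x = 1) \<and> (norm x \<ge> \<rho> + \<delta> \<longrightarrow> \<eta> x = 0) \<and> norm (grad \<eta> x) \<le> L / \<delta> \<and>
     (norm x \<le> \<rho> \<or> norm x \<ge> \<rho> + \<delta> \<longrightarrow> grad \<eta> x = 0))"

lemma radial_cutoffD:
  assumes "radial_cutoff L \<rho> \<delta> \<eta>"
  shows "\<eta> \<in> test_functions" "0 \<le> \<eta> x" "\<eta> x \<le> 1" "norm x \<le> \<rho> \<Longrightarrow> \<eta> x = 1"
    "norm x \<ge> \<rho> + \<delta> \<Longrightarrow> \<eta> x = 0" "norm (grad \<eta> x) \<le> L / \<delta>"
    "norm x \<le> \<rho> \<Longrightarrow> grad \<eta> x = 0" "norm x \<ge> \<rho> + \<delta> \<Longrightarrow> grad \<eta> x = 0"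
  using assms by (auto simp: radial_cutoff_def)

text \<open>Composing the step with \<open>norm\<^sup>2\<close> instead of \<open>norm\<close> avoids the singularity at the origin;
  the gradient is still of order \<open>1/\<delta>\<close>, uniformly in \<open>\<rho>\<close>, because the transition interval for
  \<open>norm\<^sup>2\<close> has length \<open>\<delta> (2 \<rho> + \<delta>)\<close>.\<close>

lemma smooth_cutoff:
  obtains L where "L > 0"
    "\<And>\<rho> \<delta>. \<rho> \<ge> 0 \<Longrightarrow> \<delta> > 0 \<Longrightarrow> \<exists>\<eta>::'a::euclidean_space \<Rightarrow> real. radial_cutoff L \<rho> \<delta> \<eta>"
proof -
  obtain S' L where L: "L > 0" and S': "\<And>t. (smooth_step has_real_derivative S' t) (at t)"
    "\<And>t. \<bar>S' t\<bar> \<le> L" "\<And>t. t \<le> 0 \<or> t \<ge> 1 \<Longrightarrow> S' t = 0"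
    using smooth_step_derivative by metis
  show thesis
  proof (rule that)
    show "2 * L > 0" using L by simp
    fix \<rho> \<delta> :: real assume \<rho>: "\<rho> \<ge> 0" and \<delta>: "\<delta> > 0"
    define w where "w = inverse (\<delta> * (2 * \<rho> + \<delta>))"
    define a where "a = (\<lambda>x::'a. ((norm x)\<^sup>2 - \<rho>\<^sup>2) * w)"
    define \<eta> where "\<eta> = (\<lambda>x. smooth_step (a x))"
    have w: "w > 0" using \<rho> \<delta> by (simp add: w_def)
    have a_le: "a x \<le> 0" if "norm x \<le> \<rho>" for x
      using power_mono[OF that, of 2] w by (simp add: a_def mult_nonpos_nonneg)
    have a_ge: "a x \<ge> 1" if "norm x \<ge> \<rho> + \<delta>" for x
    proof -
      have "(norm x)\<^sup>2 - \<rho>\<^sup>2 \<ge> \<delta> * (2 * \<rho> + \<delta>)"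
        using power_mono[OF that, of 2] \<rho> \<delta> by (simp add: power2_eq_square algebra_simps)
      then have "a x \<ge> (\<delta> * (2 * \<rho> + \<delta>)) * w" unfolding a_def using w by (intro mult_right_mono) auto
      moreover have "(\<delta> * (2 * \<rho> + \<delta>)) * w = 1"
        using \<rho> \<delta> unfolding w_def by (intro right_inverse) simp
      ultimately show ?thesis by simp
    qed
    have "{x. \<eta> x \<noteq> 0} \<subseteq> ball 0 (\<rho> + \<delta>)"
      using a_ge smooth_step_eq_0 by (force simp: \<eta>_def)
    then have "bounded {x. \<eta> x \<noteq> 0}" using bounded_ball bounded_subset by blast
    moreover have "Ck k \<eta>" for k
      unfolding \<eta>_def a_def
      by (intro Ck_smooth_step Ck_mult Ck_diff Ck_norm_square Ck_const)
    ultimately have \<eta>: "\<eta> \<in> test_functions" by (intro test_functionsI)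
    have "((\<lambda>x. smooth_step (a x)) has_derivative (\<lambda>v. (2 * (x \<bullet> v) * w) * S' (a x))) (at x)" for x
      unfolding a_def power2_norm_eq_inner
      by (rule DERIV_compose_FDERIV[OF S'(1)])
         (auto intro!: derivative_eq_intros simp: inner_commute algebra_simps)
    then have grad: "grad \<eta> x = (2 * w * S' (a x)) *\<^sub>R x" for x
      unfolding \<eta>_def by (intro grad_eqI) (simp add: algebra_simps)
    have grad_0: "grad \<eta> x = 0" if "norm x \<le> \<rho> \<or> norm x \<ge> \<rho> + \<delta>" for x
      using that S'(3)[of "a x"] a_le a_ge by (auto simp: grad)
    have g: "norm (grad \<eta> x) \<le> 2 * L / \<delta>" for x
    proof (cases "norm x \<ge> \<rho> + \<delta>")
      case True
      then show ?thesis using grad_0[of x] \<delta> L by simp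
    next
      case False
      have "norm (grad \<eta> x) = 2 * w * \<bar>S' (a x)\<bar> * norm x"
        using w by (simp add: grad abs_mult)
      also have "\<dots> \<le> 2 * w * L * (2 * \<rho> + \<delta>)"
        using False \<rho> \<delta> w L S'(2) by (intro mult_mono) auto
      also have "\<dots> = 2 * L * (w * (2 * \<rho> + \<delta>))" by (simp only: mult_ac)
      also have "w * (2 * \<rho> + \<delta>) = inverse \<delta>"
      proof -
        have "2 * \<rho> + \<delta> \<noteq> 0" using \<rho> \<delta> by simp
        then show ?thesis unfolding w_def inverse_mult_distrib mult.assoc by simp
      qed
      also have "2 * L * inverse \<delta> = 2 * L / \<delta>" by (simp add: divide_inverse)
      finally show ?thesis .
    qed
    have "radial_cutoff (2 * L) \<rho> \<delta> \<eta>"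
      using \<eta> g grad_0 a_le a_ge smooth_step_bounds smooth_step_eq_1 smooth_step_eq_0
      unfolding radial_cutoff_def by (auto simp: \<eta>_def)
    then show "\<exists>\<eta>::'a \<Rightarrow> real. radial_cutoff (2 * L) \<rho> \<delta> \<eta>" by blast
  qed
qed

section \<open>Uniqueness of weak gradients\<close>

text \<open>A product over the coordinates of smooth steps that steepen with \<open>n\<close> and never leave the
  box.\<close>

lemma box_indicator_approximation:
  fixes l u :: "'a::euclidean_space"
  obtains \<psi> where "\<And>n. \<psi> n \<in> test_functions" "\<And>n x. \<bar>\<psi> n x\<bar> \<le> indicator (box l u) x"
    "\<And>x. (\<lambda>n. \<psi> n x) \<longlonglongrightarrow> indicator (box l u) x"
proof
  define S where "S = (\<lambda>t. 1 - smooth_step t)"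
  have S01: "0 \<le> S t" "S t \<le> 1" for t using smooth_step_bounds by (auto simp: S_def)
  have S0: "S t = 0" if "t \<le> 0" for t using smooth_step_eq_1 that by (auto simp: S_def)
  have S1: "S t = 1" if "t \<ge> 1" for t using smooth_step_eq_0 that by (auto simp: S_def)
  define \<psi> where "\<psi> = (\<lambda>n (x::'a). \<Prod>b\<in>Basis.
      S (real n * (x \<bullet> b - l \<bullet> b)) * S (real n * (u \<bullet> b - x \<bullet> b)))"
  have outside: "\<psi> n x = 0" if x: "x \<notin> box l u" for n x
  proof -
    obtain b where b: "b \<in> Basis" "x \<bullet> b \<le> l \<bullet> b \<or> u \<bullet> b \<le> x \<bullet> b"
      using x by (auto simp: mem_box not_less)
    then have "S (real n * (x \<bullet> b - l \<bullet> b)) * S (real n * (u \<bullet> b - x \<bullet> b)) = 0"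
      using S0[OF mult_nonneg_nonpos[of "real n"]] by auto
    then show ?thesis unfolding \<psi>_def using b(1) by (intro prod_zero) auto
  qed
  show "\<psi> n \<in> test_functions" for n
  proof (rule test_functionsI)
    show "Ck k (\<psi> n)" for k unfolding \<psi>_def S_def
      by (intro Ck_prod Ck_mult Ck_diff Ck_smooth_step Ck_const Ck_inner finite_Basis)
    show "bounded {x. \<psi> n x \<noteq> 0}"
      by (rule bounded_subset[OF bounded_box[of l u]]) (use outside in auto)
  qed
  show "\<bar>\<psi> n x\<bar> \<le> indicator (box l u) x" for n x
  proof (cases "x \<in> box l u")
    case True
    have "0 \<le> \<psi> n x" "\<psi> n x \<le> 1" unfolding \<psi>_def
      using S01 by (auto intro!: prod_nonneg prod_le_1 mult_le_one)
    then show ?thesis using True by simp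
  qed (simp add: outside)
  show "(\<lambda>n. \<psi> n x) \<longlonglongrightarrow> indicator (box l u) x" for x
  proof (cases "x \<in> box l u")
    case True
    have ev: "eventually (\<lambda>n. S (real n * t) = 1) sequentially" if "t > 0" for t
    proof -
      obtain N :: nat where N: "1 < real N * t" using reals_Archimedean3[OF \<open>t > 0\<close>] by blast
      have "S (real n * t) = 1" if "n \<ge> N" for n :: nat
      proof (rule S1)
        have "real N * t \<le> real n * t" using that \<open>t > 0\<close> by (intro mult_right_mono) auto
        then show "1 \<le> real n * t" using N by simp
      qed
      then show ?thesis unfolding eventually_sequentially by (intro exI[of _ N]) simp
    qed
    have "eventually (\<lambda>n. \<forall>b\<in>Basis. S (real n * (x \<bullet> b - l \<bullet> b)) = 1 \<and>
        S (real n * (u \<bullet> b - x \<bullet> b)) = 1) sequentially"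
      using True by (intro eventually_ball_finite finite_Basis ballI eventually_conj ev)
        (auto simp: mem_box)
    then have "eventually (\<lambda>n. \<psi> n x = 1) sequentially"
      by (rule eventually_mono) (simp add: \<psi>_def)
    then show ?thesis using True by (simp add: tendsto_eventually)
  qed (simp add: outside)
qed

text \<open>Boxes form an intersection-stable generator of the Borel sets, so the vanishing of the
  integrals spreads from boxes to all Borel sets.\<close>

lemma integral_0_on_boxes_imp_AE_0:
  fixes g :: "'a::euclidean_space \<Rightarrow> 'b::{second_countable_topology, banach}"
  assumes g: "integrable lborel g"
    and box: "\<And>l u. (LINT x:box l u|lborel. g x) = 0"
  shows "AE x in lborel. g x = 0"
proof (rule sigma_finite_measure.density_zero[OF sigma_finite_lborel g])
  fix A :: "'a set" assume A: "A \<in> sets lborel"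
  have int: "set_integrable lborel A g" if "A \<in> sets lborel" for A
    using that g by (auto simp: set_integrable_def intro: integrable_mult_indicator)
  have UN: "(\<lambda>n. LINT x:box (- (real n *\<^sub>R One)) (real n *\<^sub>R One)|lborel. g x)
      \<longlonglongrightarrow> (LINT x:(\<Union>n. box (- (real n *\<^sub>R One)) (real n *\<^sub>R One))|lborel. g x)"
    by (intro set_integral_cont_up int) (auto simp: incseq_def intro!: subset_box_imp(4))
  have total: "(LINT x:UNIV|lborel. g x) = 0"
    using UN unfolding UN_box_eq_UNIV box by (simp add: LIMSEQ_const_iff)
  have "Int_stable (range (\<lambda>(a, b). box a b :: 'a set))"
    by (auto simp: Int_stable_def box_Int_box)
  moreover have "(range (\<lambda>(a, b). box a b)) \<subseteq> Pow (UNIV :: 'a set)" by auto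
  moreover have "A \<in> sigma_sets UNIV (range (\<lambda>(a, b). box a b))"
    using A[unfolded sets_lborel] unfolding borel_eq_box by simp
  ultimately show "(LINT x:A|lborel. g x) = 0"
  proof (induction rule: sigma_sets_induct_disjoint)
    case (basic A) then show ?case by (auto simp: box)
  next
    case empty then show ?case by (simp add: set_lebesgue_integral_def)
  next
    case (compl A)
    then have [measurable]: "A \<in> sets borel" by (simp add: borel_eq_box)
    have "(LINT x:(UNIV - A) \<union> A|lborel. g x) = (LINT x:UNIV - A|lborel. g x) + (LINT x:A|lborel. g x)"
      by (rule set_integral_Un) (auto intro!: int)
    then show ?case using compl total by simp
  next
    case (union F)
    then have [measurable]: "\<And>i. F i \<in> sets borel" by (simp add: borel_eq_box subset_eq)
    have "(LINT x:(\<Union>i. F i)|lborel. g x) = (\<Sum>i. LINT x:F i|lborel. g x)"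
      using union.hyps(1) by (intro lebesgue_integral_countable_add int) (auto simp: disjoint_family_on_def)
    then show ?case using union.IH by simp
  qed
qed

lemma borel_measurable_imp_lebesgue:
  "f \<in> borel_measurable borel \<Longrightarrow> f \<in> borel_measurable lebesgue"
  by (rule measurable_completion) simp

lemma borel_representative:
  fixes g :: "'a::euclidean_space \<Rightarrow> 'b::euclidean_space"
  assumes "g \<in> borel_measurable lebesgue"
  obtains g' where "g' \<in> borel_measurable borel" "AE x in lborel. g x = g' x"
proof -
  have "\<forall>b. \<exists>h. h \<in> borel_measurable borel \<and> (AE x in lborel. g x \<bullet> b = h x)"
  proof
    fix b
    have "\<exists>h\<in>borel_measurable lborel. AE x in lborel. g x \<bullet> b = h x"
      using assms by (intro completion_ex_borel_measurable_real) simp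
    then show "\<exists>h. h \<in> borel_measurable borel \<and> (AE x in lborel. g x \<bullet> b = h x)" by auto
  qed
  from choice[OF this] obtain h where h: "\<And>b. h b \<in> borel_measurable borel"
    "\<And>b. AE x in lborel. g x \<bullet> b = h b x" by blast
  show thesis
  proof
    show "(\<lambda>x. \<Sum>b\<in>Basis. h b x *\<^sub>R b) \<in> borel_measurable borel" using h(1) by measurable
    have "AE x in lborel. \<forall>b\<in>Basis. g x \<bullet> b = h b x" using h(2) by (simp add: AE_finite_all)
    then show "AE x in lborel. g x = (\<Sum>b\<in>Basis. h b x *\<^sub>R b)"
    proof eventually_elim
      case (elim x)
      have "g x = (\<Sum>b\<in>Basis. (g x \<bullet> b) *\<^sub>R b)" by (rule euclidean_representation[symmetric])
      also have "\<dots> = (\<Sum>b\<in>Basis. h b x *\<^sub>R b)" using elim by (intro sum.cong) auto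
      finally show ?case .
    qed
  qed
qed

lemma loc_integrable_borel_measurable:
  assumes "loc_integrable g"
  shows "g \<in> borel_measurable lebesgue"
proof (rule borel_measurable_LIMSEQ_metric)
  show "(\<lambda>x. indicat_real (cball 0 (real n)) x *\<^sub>R g x) \<in> borel_measurable lebesgue" for n
  proof -
    have "integrable lebesgue (\<lambda>x. indicat_real (cball 0 (real n)) x *\<^sub>R g x)"
      using assms compact_cball unfolding loc_integrable_def set_integrable_def by blast
    then show ?thesis by (rule borel_measurable_integrable)
  qed
  show "(\<lambda>n. indicat_real (cball 0 (real n)) x *\<^sub>R g x) \<longlonglongrightarrow> g x" for x
  proof (rule tendsto_eventually)
    obtain N where "norm x \<le> real N" using real_arch_simple by blast
    then show "eventually (\<lambda>n. indicat_real (cball 0 (real n)) x *\<^sub>R g x = g x) sequentially"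
      by (auto simp: eventually_sequentially intro!: exI[of _ N])
  qed
qed

lemma AE_lebesgue_iff: "(AE x in lebesgue. P x) \<longleftrightarrow> (AE x in lborel. P x)"
  using AE_completion_iff by blast

text \<open>The fundamental lemma of the calculus of variations: indicators of boxes are bounded
  pointwise limits of test functions, and boxes generate the Borel sets.\<close>

lemma fundamental_lemma:
  fixes g :: "'a::euclidean_space \<Rightarrow> 'b::euclidean_space"
  assumes g: "loc_integrable g"
    and orth: "\<And>\<phi>. \<phi> \<in> test_functions \<Longrightarrow> (\<integral>x. \<phi> x *\<^sub>R g x \<partial>lebesgue) = 0"
  shows "AE x in lebesgue. g x = 0"
proof -
  note [measurable] = loc_integrable_borel_measurable[OF g]
  obtain g' where g'[measurable]: "g' \<in> borel_measurable borel" and eq: "AE x in lborel. g x = g' x"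
    using borel_representative loc_integrable_borel_measurable[OF g] by metis
  have int: "integrable lborel (\<lambda>x. indicator (box l u) x *\<^sub>R g' x)" for l u :: 'a
  proof -
    have "set_integrable lebesgue (cbox l u) g" using g by (simp add: loc_integrable_def)
    then have "set_integrable lebesgue (box l u) g"
      by (rule set_integrable_subset) (auto simp: box_subset_cbox)
    then have "integrable lebesgue (\<lambda>x. indicator (box l u) x *\<^sub>R g' x)"
      unfolding set_integrable_def
      by (rule integrable_cong_AE_imp)
         (use eq in \<open>auto simp: AE_lebesgue_iff elim: eventually_mono intro: measurable_completion\<close>)
    then show ?thesis by (simp add: integrable_completion)
  qed
  have zero: "(LINT x:box l u|lborel. g' x) = 0" for l u :: 'a
  proof -
    obtain \<psi> where \<psi>: "\<And>n. \<psi> n \<in> test_functions" "\<And>n x. \<bar>\<psi> n x\<bar> \<le> indicator (box l u) x"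
      "\<And>x. (\<lambda>n. \<psi> n x) \<longlonglongrightarrow> indicator (box l u) x"
      using box_indicator_approximation by metis
    note [measurable] = test_function_measurable(1)[OF \<psi>(1)]
      borel_measurable_imp_lebesgue[OF test_function_measurable(1)[OF \<psi>(1)]]
      borel_measurable_imp_lebesgue[OF g']
    have "(\<lambda>n. \<integral>x. \<psi> n x *\<^sub>R g' x \<partial>lborel) \<longlonglongrightarrow> (\<integral>x. indicator (box l u) x *\<^sub>R g' x \<partial>lborel)"
    proof (rule integral_dominated_convergence)
      show "integrable lborel (\<lambda>x. norm (indicator (box l u) x *\<^sub>R g' x))"
        by (rule integrable_norm[OF int])
      show "AE x in lborel. (\<lambda>n. \<psi> n x *\<^sub>R g' x) \<longlonglongrightarrow> indicator (box l u) x *\<^sub>R g' x"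
        by (intro AE_I2 tendsto_intros \<psi>(3))
      show "AE x in lborel. norm (\<psi> n x *\<^sub>R g' x) \<le> norm (indicat_real (box l u) x *\<^sub>R g' x)" for n
        using \<psi>(2) by (intro AE_I2) (auto intro!: mult_right_mono)
    qed auto
    moreover have "(\<integral>x. \<psi> n x *\<^sub>R g' x \<partial>lborel) = 0" for n
    proof -
      have "(\<integral>x. \<psi> n x *\<^sub>R g' x \<partial>lborel) = (\<integral>x. \<psi> n x *\<^sub>R g' x \<partial>lebesgue)"
        by (simp add: integral_completion)
      also have "\<dots> = (\<integral>x. \<psi> n x *\<^sub>R g x \<partial>lebesgue)"
        by (rule integral_cong_AE) (use eq in \<open>auto simp: AE_lebesgue_iff elim: eventually_mono\<close>)
      finally show ?thesis using orth[OF \<psi>(1)] by simp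
    qed
    ultimately show ?thesis by (simp add: set_lebesgue_integral_def LIMSEQ_const_iff)
  qed
  have "AE x in lborel. \<forall>n. indicator (box (- (real n *\<^sub>R One)) (real n *\<^sub>R One)) x *\<^sub>R g' x = 0"
    unfolding AE_all_countable
  proof
    fix n
    let ?B = "box (- (real n *\<^sub>R One)) (real n *\<^sub>R One) :: 'a set"
    have "(LINT x:box l u|lborel. indicat_real ?B x *\<^sub>R g' x) = (LINT x:box l u \<inter> ?B|lborel. g' x)"
      for l u by (simp add: set_lebesgue_integral_def indicator_inter_arith)
    then show "AE x in lborel. indicator ?B x *\<^sub>R g' x = 0"
      by (intro integral_0_on_boxes_imp_AE_0 int) (simp add: box_Int_box zero)
  qed
  then have "AE x in lborel. g x = 0"
    using eq
  proof eventually_elim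
    case (elim x)
    have "x \<in> (\<Union>n. box (- (real n *\<^sub>R One)) (real n *\<^sub>R One))" unfolding UN_box_eq_UNIV by simp
    then show ?case using elim by (auto simp: indicator_def)
  qed
  then show ?thesis by (simp add: AE_lebesgue_iff)
qed

lemma integrable_test_function_scaleR:
  fixes g :: "'a::euclidean_space \<Rightarrow> 'b::euclidean_space"
  assumes g: "loc_integrable g" and \<phi>: "\<phi> \<in> test_functions"
  shows "integrable lebesgue (\<lambda>x. \<phi> x *\<^sub>R g x)"
proof -
  let ?K = "closure {x. \<phi> x \<noteq> 0}"
  obtain C where C: "C > 0" "\<And>x. \<bar>\<phi> x\<bar> \<le> C"
    by (rule test_function_bounded[OF \<phi>]) blast
  have "compact ?K" using \<phi> by (simp add: test_functions_def)
  then have "integrable lebesgue (\<lambda>x. indicator ?K x *\<^sub>R g x)"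
    using g unfolding loc_integrable_def set_integrable_def by blast
  then have "integrable lebesgue (\<lambda>x. C *\<^sub>R (indicator ?K x *\<^sub>R g x))" by (rule integrable_scaleR_right)
  then show ?thesis
  proof (rule Bochner_Integration.integrable_bound)
    show "AE x in lebesgue. norm (\<phi> x *\<^sub>R g x) \<le> norm (C *\<^sub>R (indicat_real ?K x *\<^sub>R g x))"
    proof (rule AE_I2)
      fix x
      have "x \<in> ?K" if "\<phi> x \<noteq> 0" by (rule subsetD[OF closure_subset]) (simp add: that)
      then have "\<bar>\<phi> x\<bar> \<le> C * indicat_real ?K x" using C(2)[of x] C(1) by (cases "\<phi> x = 0") auto
      then show "norm (\<phi> x *\<^sub>R g x) \<le> norm (C *\<^sub>R (indicat_real ?K x *\<^sub>R g x))"
        using C(1) by (simp add: mult_right_mono)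
    qed
  qed (intro borel_measurable_scaleR loc_integrable_borel_measurable[OF g]
      borel_measurable_imp_lebesgue[OF test_function_measurable(1)[OF \<phi>]])
qed

lemma loc_integrable_diff:
  fixes g h :: "'a::euclidean_space \<Rightarrow> 'b::euclidean_space"
  assumes "loc_integrable g" "loc_integrable h"
  shows "loc_integrable (\<lambda>x. g x - h x)"
  unfolding loc_integrable_def
proof (intro allI impI)
  fix K :: "'a set" assume "compact K"
  then have "set_integrable lebesgue K g" "set_integrable lebesgue K h"
    using assms unfolding loc_integrable_def by blast+
  then show "set_integrable lebesgue K (\<lambda>x. g x - h x)" by (rule set_integral_diff(1))
qed

lemma weak_gradient_unique:
  assumes g: "has_weak_gradient u g" and h: "has_weak_gradient u h"
  shows "AE x in lebesgue. g x = h x"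
proof -
  have loc: "loc_integrable g" "loc_integrable h" using g h by (auto simp: has_weak_gradient_def)
  have "AE x in lebesgue. g x - h x = 0"
  proof (rule fundamental_lemma[OF loc_integrable_diff[OF loc]])
    fix \<phi> :: "'a \<Rightarrow> real" assume \<phi>: "\<phi> \<in> test_functions"
    have "(\<integral>x. \<phi> x *\<^sub>R g x \<partial>lebesgue) = (\<integral>x. \<phi> x *\<^sub>R h x \<partial>lebesgue)"
      using g h \<phi> unfolding has_weak_gradient_def by (metis neg_equal_iff_equal)
    then show "(\<integral>x. \<phi> x *\<^sub>R (g x - h x) \<partial>lebesgue) = 0"
      using Bochner_Integration.integral_diff[OF loc[THEN integrable_test_function_scaleR[OF _ \<phi>]]]
      by (simp add: scaleR_diff_right)
  qed
  then show ?thesis by simp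
qed

lemma has_weak_gradient_weak_grad:
  "has_weak_gradient u g \<Longrightarrow> has_weak_gradient u (weak_grad u)"
  unfolding weak_grad_def by (rule someI[of "has_weak_gradient u"])

lemma weak_grad_AE_eq:
  assumes "has_weak_gradient u g"
  shows "AE x in lebesgue. weak_grad u x = g x"
  by (rule weak_gradient_unique[OF has_weak_gradient_weak_grad[OF assms] assms])

section \<open>Translation estimates and interpolation\<close>

text \<open>The Cauchy-Schwarz inequality on the unit interval, in the form \<open>\<integral> (a - m)\<^sup>2 \<ge> 0\<close>.\<close>

lemma square_integral_le_integral_square:
  fixes a :: "real \<Rightarrow> real"
  assumes m: "(a has_integral m) {0..1}" and a: "continuous_on {0..1} a"
  shows "ennreal (m\<^sup>2) \<le> (\<integral>\<^sup>+t. ennreal ((a t)\<^sup>2) * indicator {0..1} t \<partial>lborel)"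
proof -
  obtain I where I: "((\<lambda>t. (a t)\<^sup>2) has_integral I) {0..1}"
    using integrable_continuous_interval[OF continuous_on_power[OF a, of 2]] by (auto simp: integrable_on_def)
  have "((\<lambda>t. (a t)\<^sup>2 - 2 * m * a t + m\<^sup>2) has_integral I - 2 * m * m + m\<^sup>2) {0..1}"
    using has_integral_const_real[of "m\<^sup>2" 0 1]
    by (intro has_integral_add has_integral_diff has_integral_mult_right I m) auto
  then have "((\<lambda>t. (a t - m)\<^sup>2) has_integral I - m\<^sup>2) {0..1}"
    by (simp add: power2_eq_square algebra_simps)
  then have "0 \<le> I - m\<^sup>2" by (rule has_integral_nonneg) simp
  moreover have "(\<integral>\<^sup>+t. ennreal ((a t)\<^sup>2) * indicator {0..1} t \<partial>lborel) = ennreal I"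
  proof -
    have "integral\<^sup>N lborel (\<lambda>t. ennreal (indicator {0..1} t * (a t)\<^sup>2)) = ennreal I"
    proof (rule nn_integral_has_integral_lborel)
      show "((\<lambda>t. indicator {0..1} t * (a t)\<^sup>2) has_integral I) UNIV"
      proof -
        have "(\<lambda>t. indicator {0..1} t * (a t)\<^sup>2) = (\<lambda>t. if t \<in> {0..1} then (a t)\<^sup>2 else 0)"
          by (auto simp: indicator_def)
        then show ?thesis using I by (simp only: has_integral_restrict_UNIV)
      qed
      show "(\<lambda>t. indicator {0..1} t * (a t)\<^sup>2) \<in> borel_measurable borel"
        using borel_measurable_continuous_on_indicator[of "{0..1}" "\<lambda>t. (a t)\<^sup>2"]
          continuous_on_power[OF a, of 2] by simp
    qed simp
    also have "(\<lambda>t. ennreal (indicator {0..1} t * (a t)\<^sup>2)) = (\<lambda>t. ennreal ((a t)\<^sup>2) * indicator {0..1} t)"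
      by (auto simp: indicator_def)
    finally show ?thesis .
  qed
  ultimately show ?thesis by (simp add: ennreal_leI)
qed

lemma test_function_increment:
  fixes z :: "'a::euclidean_space"
  assumes \<phi>: "\<phi> \<in> test_functions"
  shows "ennreal ((\<phi> (x + z) - \<phi> x)\<^sup>2) \<le>
    (\<integral>\<^sup>+t. ennreal ((norm z)\<^sup>2 * (norm (grad \<phi> (x + t *\<^sub>R z)))\<^sup>2) * indicator {0..1} t \<partial>lborel)"
proof -
  have "((\<lambda>t. \<phi> (x + t *\<^sub>R z)) has_vector_derivative grad \<phi> (x + t *\<^sub>R z) \<bullet> z) (at t within {0..1})" for t :: real
  proof -
    have "((\<lambda>t. x + t *\<^sub>R z) has_derivative (\<lambda>s. s *\<^sub>R z)) (at t within {0..1})"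
      by (auto intro!: derivative_eq_intros)
    then show ?thesis unfolding has_vector_derivative_def
      using has_derivative_compose[OF _ test_function_has_derivative[OF \<phi>]] by fastforce
  qed
  then have "((\<lambda>t. grad \<phi> (x + t *\<^sub>R z) \<bullet> z) has_integral \<phi> (x + z) - \<phi> x) {0..1}"
    using fundamental_theorem_of_calculus[of 0 1 "\<lambda>t. \<phi> (x + t *\<^sub>R z)"] by simp
  moreover have "continuous_on {0..1} (\<lambda>t. grad \<phi> (x + t *\<^sub>R z) \<bullet> z)"
    by (intro continuous_intros continuous_on_compose2[OF test_function_continuous(2)[OF \<phi>]]) auto
  ultimately have "ennreal ((\<phi> (x + z) - \<phi> x)\<^sup>2) \<le>
      (\<integral>\<^sup>+t. ennreal ((grad \<phi> (x + t *\<^sub>R z) \<bullet> z)\<^sup>2) * indicator {0..1} t \<partial>lborel)"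
    by (rule square_integral_le_integral_square)
  also have "\<dots> \<le> (\<integral>\<^sup>+t. ennreal ((norm z)\<^sup>2 * (norm (grad \<phi> (x + t *\<^sub>R z)))\<^sup>2) * indicator {0..1} t \<partial>lborel)"
  proof (intro nn_integral_mono mult_right_mono ennreal_leI)
    fix t
    show "(grad \<phi> (x + t *\<^sub>R z) \<bullet> z)\<^sup>2 \<le> (norm z)\<^sup>2 * (norm (grad \<phi> (x + t *\<^sub>R z)))\<^sup>2"
      using Cauchy_Schwarz_ineq[of "grad \<phi> (x + t *\<^sub>R z)" z]
      by (simp add: power2_norm_eq_inner mult.commute)
  qed simp
  finally show ?thesis .
qed

lemma nn_integral_shift:
  fixes f :: "'a::euclidean_space \<Rightarrow> ennreal"
  assumes [measurable]: "f \<in> borel_measurable borel"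
  shows "(\<integral>\<^sup>+x. f (c + x) \<partial>lborel) = (\<integral>\<^sup>+x. f x \<partial>lborel)"
proof -
  have "(\<integral>\<^sup>+x. f x \<partial>lborel) = (\<integral>\<^sup>+x. f x \<partial>distr lborel borel ((+) c))"
    by (simp only: lborel_distr_plus)
  also have "\<dots> = (\<integral>\<^sup>+x. f (c + x) \<partial>lborel)" by (rule nn_integral_distr) auto
  finally show ?thesis ..
qed

text \<open>The increment of \<open>\<phi>\<close> is integrated along the segment from \<open>x\<close> to \<open>x + z\<close>. By Tonelli's
  theorem and translation invariance, each point \<open>x + t *\<^sub>R z\<close> of the segment contributes at most
  the energy on \<open>S'\<close>. Keeping track of \<open>S'\<close> makes the estimate usable outside a ball.\<close>

lemma test_function_translation:
  fixes z :: "'a::euclidean_space"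
  assumes \<phi>: "\<phi> \<in> test_functions" and [measurable]: "S \<in> sets borel" "S' \<in> sets borel"
    and sub: "\<And>x t. x \<in> S \<Longrightarrow> 0 \<le> t \<Longrightarrow> t \<le> 1 \<Longrightarrow> x + t *\<^sub>R z \<in> S'"
  shows "(\<integral>\<^sup>+x\<in>S. ennreal ((\<phi> (x + z) - \<phi> x)\<^sup>2) \<partial>lborel) \<le>
    ennreal ((norm z)\<^sup>2) * (\<integral>\<^sup>+x\<in>S'. ennreal ((norm (grad \<phi> x))\<^sup>2) \<partial>lborel)"
    (is "_ \<le> _ * ?G")
proof -
  note [measurable] = test_function_measurable[OF \<phi>]
  let ?f = "\<lambda>x t. ennreal ((norm z)\<^sup>2 * (norm (grad \<phi> (x + t *\<^sub>R z)))\<^sup>2) * indicator {0..1::real} t * indicator S x"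
  have "(\<integral>\<^sup>+x\<in>S. ennreal ((\<phi> (x + z) - \<phi> x)\<^sup>2) \<partial>lborel) \<le> (\<integral>\<^sup>+x. (\<integral>\<^sup>+t. ?f x t \<partial>lborel) \<partial>lborel)"
  proof (rule nn_integral_mono)
    fix x
    have "ennreal ((\<phi> (x + z) - \<phi> x)\<^sup>2) * indicator S x \<le> (\<integral>\<^sup>+t. ennreal ((norm z)\<^sup>2 * (norm (grad \<phi> (x + t *\<^sub>R z)))\<^sup>2) * indicator {0..1} t \<partial>lborel) * indicator S x"
      by (intro mult_right_mono test_function_increment[OF \<phi>]) simp
    also have "\<dots> = (\<integral>\<^sup>+t. ?f x t \<partial>lborel)" by (rule nn_integral_multc[symmetric]) simp
    finally show "ennreal ((\<phi> (x + z) - \<phi> x)\<^sup>2) * indicator S x \<le> (\<integral>\<^sup>+t. ?f x t \<partial>lborel)" .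
  qed
  also have "\<dots> = (\<integral>\<^sup>+t. (\<integral>\<^sup>+x. ?f x t \<partial>lborel) \<partial>lborel)"
    by (rule lborel_pair.Fubini'[symmetric]) simp
  also have "\<dots> \<le> (\<integral>\<^sup>+t. ennreal ((norm z)\<^sup>2) * ?G * indicator {0..1::real} t \<partial>lborel)"
  proof (rule nn_integral_mono)
    fix t :: real
    show "(\<integral>\<^sup>+x. ?f x t \<partial>lborel) \<le> ennreal ((norm z)\<^sup>2) * ?G * indicator {0..1::real} t"
    proof (cases "t \<in> {0..1}")
      case True
      have "(\<integral>\<^sup>+x. ?f x t \<partial>lborel) \<le> (\<integral>\<^sup>+x. ennreal ((norm z)\<^sup>2) *
          (ennreal ((norm (grad \<phi> (t *\<^sub>R z + x)))\<^sup>2) * indicator S' (t *\<^sub>R z + x)) \<partial>lborel)"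
        using True sub by (intro nn_integral_mono) (auto simp: indicator_def ennreal_mult add.commute)
      also have "\<dots> = ennreal ((norm z)\<^sup>2) * (\<integral>\<^sup>+x.
          (ennreal ((norm (grad \<phi> (t *\<^sub>R z + x)))\<^sup>2) * indicator S' (t *\<^sub>R z + x)) \<partial>lborel)"
        by (rule nn_integral_cmult) simp
      also have "(\<integral>\<^sup>+x. (ennreal ((norm (grad \<phi> (t *\<^sub>R z + x)))\<^sup>2) * indicator S' (t *\<^sub>R z + x)) \<partial>lborel) = ?G"
        by (rule nn_integral_shift) simp
      finally show ?thesis using True by simp
    qed simp
  qed
  also have "\<dots> = ennreal ((norm z)\<^sup>2) * ?G" by (simp add: nn_integral_cmult_indicator)
  finally show ?thesis .
qed

text \<open>What membership of \<^const>\<open>H1_dot\<close> provides, restated for Borel representatives with respect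
  to Borel-Lebesgue measure: the functions \<open>(x, z) \<mapsto> u (x + z)\<close> below have to be jointly measurable
  before Tonelli's theorem applies, which can fail for Lebesgue measurable \<open>u\<close>.\<close>

definition gradient_limit ::
  "(nat \<Rightarrow> 'a::euclidean_space \<Rightarrow> real) \<Rightarrow> ('a \<Rightarrow> real) \<Rightarrow> ('a \<Rightarrow> 'a) \<Rightarrow> bool" where
  "gradient_limit \<phi> u g \<longleftrightarrow> u \<in> borel_measurable borel \<and> g \<in> borel_measurable borel \<and>
     (\<forall>n. \<phi> n \<in> test_functions) \<and>
     (\<lambda>n. \<integral>\<^sup>+x. ennreal ((norm (g x - grad (\<phi> n) x))\<^sup>2) \<partial>lborel) \<longlonglongrightarrow> 0 \<and>
     (\<forall>R. set_integrable lborel (cball 0 R) u) \<and>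
     (\<forall>R. (\<lambda>n. LINT x:cball 0 R|lborel. \<bar>u x - \<phi> n x\<bar>) \<longlonglongrightarrow> 0)"

lemma test_function_set_integrable:
  "\<phi> \<in> test_functions \<Longrightarrow> compact K \<Longrightarrow> set_integrable lborel K \<phi>"
  unfolding set_integrable_def
  by (rule borel_integrable_compact) (auto intro: continuous_on_subset[OF test_function_continuous(1)])

lemma gradient_limit_diff:
  assumes "gradient_limit \<phi> u g"
  shows "gradient_limit (\<lambda>m x. \<phi> m x - \<phi> n x) (\<lambda>x. u x - \<phi> n x) (\<lambda>x. g x - grad (\<phi> n) x)"
proof -
  have \<phi>: "\<phi> n \<in> test_functions" for n using assms by (simp add: gradient_limit_def)
  have [measurable]: "u \<in> borel_measurable borel" "g \<in> borel_measurable borel"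
    using assms by (auto simp: gradient_limit_def)
  note [measurable] = test_function_measurable[OF \<phi>]
  have "set_integrable lborel (cball 0 R) (\<lambda>x. u x - \<phi> n x)" for R
    using assms test_function_set_integrable[OF \<phi> compact_cball]
    by (intro set_integral_diff(1)) (auto simp: gradient_limit_def)
  then show ?thesis
    using assms by (simp add: gradient_limit_def test_function_diff[OF \<phi> \<phi>])
qed

lemma ennreal_square_add_le:
  fixes a b :: "'a::real_inner"
  shows "ennreal ((norm (a + b))\<^sup>2) \<le> 2 * ennreal ((norm a)\<^sup>2) + 2 * ennreal ((norm b)\<^sup>2)"
proof -
  have "(norm (a + b))\<^sup>2 \<le> 2 * (norm a)\<^sup>2 + 2 * (norm b)\<^sup>2"
  proof -
    have "(norm (a + b))\<^sup>2 \<le> (norm a + norm b)\<^sup>2" by (simp add: power_mono norm_triangle_ineq)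
    also have "\<dots> \<le> 2 * (norm a)\<^sup>2 + 2 * (norm b)\<^sup>2"
      using zero_le_power2[of "norm a - norm b"] by (simp add: power2_sum power2_diff)
    finally show ?thesis .
  qed
  then have "ennreal ((norm (a + b))\<^sup>2) \<le> ennreal (2 * (norm a)\<^sup>2 + 2 * (norm b)\<^sup>2)" by (rule ennreal_leI)
  also have "\<dots> = 2 * ennreal ((norm a)\<^sup>2) + 2 * ennreal ((norm b)\<^sup>2)"
    by (simp add: ennreal_plus ennreal_mult)
  finally show ?thesis .
qed

lemma AE_shift:
  fixes c :: "'a::euclidean_space"
  assumes "AE x in lborel. P x"
  shows "AE x in lborel. P (c + x)"
proof (rule AE_distrD[of "(+) c" lborel borel])
  show "(+) c \<in> lborel \<rightarrow>\<^sub>M borel" by simp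
  show "AE x in distr lborel borel ((+) c). P x" using assms by (simp only: lborel_distr_plus)
qed

text \<open>Convergence in \<open>L\<^sup>1\<close> on a ball gives almost everywhere convergence of a subsequence, so the
  estimate for test functions passes to the limit by Fatou's lemma. The factor two comes from
  bounding \<open>\<bar>\<nabla>\<phi>\<^sub>n\<bar>\<^sup>2\<close> by \<open>2 \<bar>g\<bar>\<^sup>2 + 2 \<bar>g - \<nabla>\<phi>\<^sub>n\<bar>\<^sup>2\<close>.\<close>

lemma gradient_limit_translation:
  fixes z :: "'a::euclidean_space"
  assumes lim: "gradient_limit \<phi> u g"
    and [measurable]: "S \<in> sets borel" "S' \<in> sets borel" and S: "bounded S"
    and sub: "\<And>x t. x \<in> S \<Longrightarrow> 0 \<le> t \<Longrightarrow> t \<le> 1 \<Longrightarrow> x + t *\<^sub>R z \<in> S'"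
  shows "(\<integral>\<^sup>+x\<in>S. ennreal ((u (x + z) - u x)\<^sup>2) \<partial>lborel) \<le>
    2 * ennreal ((norm z)\<^sup>2) * (\<integral>\<^sup>+x\<in>S'. ennreal ((norm (g x))\<^sup>2) \<partial>lborel)"
proof -
  have \<phi>: "\<phi> n \<in> test_functions" for n using lim by (simp add: gradient_limit_def)
  have [measurable]: "u \<in> borel_measurable borel" "g \<in> borel_measurable borel"
    using lim by (auto simp: gradient_limit_def)
  note [measurable] = test_function_measurable[OF \<phi>]
  obtain R where R: "\<And>x. x \<in> S \<Longrightarrow> norm x \<le> R" using S by (auto simp: bounded_iff)
  let ?B = "cball 0 (R + norm z) :: 'a set"
  have "\<exists>r. strict_mono r \<and> (AE x in lborel. (\<lambda>n. indicator ?B x *\<^sub>R (u x - \<phi> (r n) x)) \<longlonglongrightarrow> 0)"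
  proof (rule tendsto_L1_AE_subseq)
    show "integrable lborel (\<lambda>x. indicator ?B x *\<^sub>R (u x - \<phi> n x))" for n
      using gradient_limit_diff[OF lim, of n] by (auto simp: gradient_limit_def set_integrable_def)
    show "(\<lambda>n. \<integral>x. norm (indicator ?B x *\<^sub>R (u x - \<phi> n x)) \<partial>lborel) \<longlonglongrightarrow> 0"
      using lim by (simp add: gradient_limit_def set_lebesgue_integral_def abs_mult)
  qed
  then obtain r where r: "strict_mono r"
    and ae: "AE x in lborel. (\<lambda>n. indicator ?B x *\<^sub>R (u x - \<phi> (r n) x)) \<longlonglongrightarrow> 0" by blast
  let ?F = "\<lambda>n x. ennreal ((\<phi> (r n) (x + z) - \<phi> (r n) x)\<^sup>2) * indicator S x"
  let ?D = "\<lambda>n. \<integral>\<^sup>+x. ennreal ((norm (g x - grad (\<phi> n) x))\<^sup>2) \<partial>lborel"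
  let ?G = "\<integral>\<^sup>+x\<in>S'. ennreal ((norm (g x))\<^sup>2) \<partial>lborel"
  have conv: "AE x in lborel. (\<lambda>n. ?F n x) \<longlonglongrightarrow> ennreal ((u (x + z) - u x)\<^sup>2) * indicator S x"
    using ae AE_shift[OF ae, of z]
  proof eventually_elim
    case (elim x)
    show ?case
    proof (cases "x \<in> S")
      case True
      have "norm (z + x) \<le> R + norm z"
        using R[OF True] norm_triangle_ineq[of z x] by simp
      moreover have "norm x \<le> R + norm z" using R[OF True] by (smt (verit) norm_ge_zero)
      ultimately have "(\<lambda>n. u x - \<phi> (r n) x) \<longlonglongrightarrow> 0" "(\<lambda>n. u (x + z) - \<phi> (r n) (x + z)) \<longlonglongrightarrow> 0"
        using elim by (simp_all add: add.commute[of z])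
      then have "(\<lambda>n. \<phi> (r n) x) \<longlonglongrightarrow> u x" "(\<lambda>n. \<phi> (r n) (x + z)) \<longlonglongrightarrow> u (x + z)"
        using LIM_zero_cancel[of "\<lambda>n. \<phi> (r n) x" "u x" sequentially]
          LIM_zero_cancel[of "\<lambda>n. \<phi> (r n) (x + z)" "u (x + z)" sequentially]
        by (auto dest: tendsto_minus simp: minus_diff_eq)
      then show ?thesis using True by (auto intro!: tendsto_intros tendsto_ennrealI)
    qed simp
  qed
  have "(\<integral>\<^sup>+x\<in>S. ennreal ((u (x + z) - u x)\<^sup>2) \<partial>lborel) = (\<integral>\<^sup>+x. liminf (\<lambda>n. ?F n x) \<partial>lborel)"
  proof (rule nn_integral_cong_AE)
    show "AE x in lborel. ennreal ((u (x + z) - u x)\<^sup>2) * indicator S x = liminf (\<lambda>n. ?F n x)"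
      using conv by eventually_elim (rule lim_imp_Liminf[OF sequentially_bot, symmetric])
  qed
  also have "\<dots> \<le> liminf (\<lambda>n. \<integral>\<^sup>+x. ?F n x \<partial>lborel)" by (rule nn_integral_liminf) simp
  also have "\<dots> \<le> liminf (\<lambda>n. ennreal ((norm z)\<^sup>2) * (2 * ?G + 2 * ?D (r n)))"
  proof (intro Liminf_mono always_eventually allI)
    fix n
    have "(\<integral>\<^sup>+x. ?F n x \<partial>lborel) \<le> ennreal ((norm z)\<^sup>2) * (\<integral>\<^sup>+x\<in>S'. ennreal ((norm (grad (\<phi> (r n)) x))\<^sup>2) \<partial>lborel)"
      by (rule test_function_translation[OF \<phi>]) (use sub in auto)
    also have "(\<integral>\<^sup>+x\<in>S'. ennreal ((norm (grad (\<phi> (r n)) x))\<^sup>2) \<partial>lborel) \<le>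
        (\<integral>\<^sup>+x. 2 * (ennreal ((norm (g x))\<^sup>2) * indicator S' x) + 2 * ennreal ((norm (g x - grad (\<phi> (r n)) x))\<^sup>2) \<partial>lborel)"
    proof (rule nn_integral_mono)
      fix x
      show "ennreal ((norm (grad (\<phi> (r n)) x))\<^sup>2) * indicator S' x \<le>
        2 * (ennreal ((norm (g x))\<^sup>2) * indicator S' x) + 2 * ennreal ((norm (g x - grad (\<phi> (r n)) x))\<^sup>2)"
        using ennreal_square_add_le[of "g x" "grad (\<phi> (r n)) x - g x"]
        by (cases "x \<in> S'") (auto simp: norm_minus_commute)
    qed
    also have "\<dots> = 2 * ?G + 2 * ?D (r n)" by (simp add: nn_integral_add nn_integral_cmult)
    finally show "(\<integral>\<^sup>+x. ?F n x \<partial>lborel) \<le> ennreal ((norm z)\<^sup>2) * (2 * ?G + 2 * ?D (r n))"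
      by (simp add: mult_left_mono)
  qed
  also have "\<dots> = ennreal ((norm z)\<^sup>2) * (2 * ?G + 2 * 0)"
  proof (rule lim_imp_Liminf)
    have "?D \<longlonglongrightarrow> 0" using lim by (simp add: gradient_limit_def)
    then have "(\<lambda>n. ?D (r n)) \<longlonglongrightarrow> 0" using LIMSEQ_subseq_LIMSEQ[OF _ r] by (simp add: o_def)
    then show "(\<lambda>n. ennreal ((norm z)\<^sup>2) * (2 * ?G + 2 * ?D (r n))) \<longlonglongrightarrow> ennreal ((norm z)\<^sup>2) * (2 * ?G + 2 * 0)"
      by (intro ennreal_tendsto_cmult tendsto_add tendsto_const) auto
  qed simp
  finally show ?thesis by (simp add: mult_ac)
qed

text \<open>A point at which \<open>w\<close> exceeds the level \<open>M\<close> sees, by Markov's inequality, values of at most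
  half that size on at least half of the ball of radius \<open>h\<close> around it, so there \<open>w\<^sup>2\<close> is
  controlled by the mean square increment; below the level \<open>M\<close>, \<open>w\<^sup>2\<close> is at most
  \<open>M\<^bsup>2-r\<^esup> \<bar>w\<bar>\<^bsup>r\<^esup>\<close>.\<close>

lemma square_le_mean_square_increment:
  fixes w :: "'a::euclidean_space \<Rightarrow> real" and h r A :: real
  defines "V \<equiv> measure lborel (ball (0::'a) h)"
  assumes [measurable]: "w \<in> borel_measurable borel" "S' \<in> sets borel"
    and h: "h > 0" and r: "0 < r" "r \<le> 2" and A0: "A \<ge> 0"
    and sub: "\<And>z. norm z < h \<Longrightarrow> x + z \<in> S'"
    and A: "(\<integral>\<^sup>+y\<in>S'. ennreal (\<bar>w y\<bar> powr r) \<partial>lborel) \<le> ennreal A"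
  shows "ennreal ((w x)\<^sup>2) \<le>
    ennreal (8 / V) * (\<integral>\<^sup>+z\<in>ball 0 h. ennreal ((w (x + z) - w x)\<^sup>2) \<partial>lborel) +
    ennreal ((2 powr (r + 1) * A / V) powr ((2 - r) / r)) * ennreal (\<bar>w x\<bar> powr r)"
proof -
  have V: "V > 0" using h content_ball_pos[OF h, of "0::'a"] by (simp add: V_def)
  define M where "M = (2 powr (r + 1) * A / V) powr (1 / r)"
  have M_powr: "M powr r = 2 powr (r + 1) * A / V" using V A0 r by (simp add: M_def powr_powr)
  have M_powr': "M powr (2 - r) = (2 powr (r + 1) * A / V) powr ((2 - r) / r)"
    by (simp add: M_def powr_powr)
  have M0: "M \<ge> 0" by (simp add: M_def)
  let ?I = "\<integral>\<^sup>+z\<in>ball 0 h. ennreal ((w (x + z) - w x)\<^sup>2) \<partial>lborel"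
  define a where "a = \<bar>w x\<bar>"
  show ?thesis
  proof (cases "a \<le> M")
    case True
    have "(w x)\<^sup>2 \<le> M powr (2 - r) * a powr r"
    proof (cases "w x = 0")
      case False
      then have a: "a > 0" by (simp add: a_def)
      have "(w x)\<^sup>2 = a powr 2" using a by (simp add: a_def)
      also have "\<dots> = a powr (2 - r) * a powr r" by (simp add: powr_add[symmetric])
      also have "\<dots> \<le> M powr (2 - r) * a powr r"
        using True a r by (intro mult_right_mono powr_mono2) auto
      finally show ?thesis .
    qed (simp add: a_def)
    then have "ennreal ((w x)\<^sup>2) \<le> ennreal (M powr (2 - r)) * ennreal (\<bar>w x\<bar> powr r)"
      by (simp add: a_def ennreal_mult'[symmetric] ennreal_leI)
    then show ?thesis unfolding M_powr'[symmetric] by (rule order_trans) simp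
  next
    case False
    then have a: "a > 0" "a > M" using M0 by auto
    define bad where "bad = {z \<in> ball 0 h. \<bar>w (x + z)\<bar> > a / 2}"
    \<comment> \<open>By Markov's inequality, the set \<open>bad\<close> fills at most half of the ball.\<close>
    have bad_meas[measurable]: "bad \<in> sets borel" unfolding bad_def by measurable
    have fin: "emeasure lborel X = ennreal (measure lborel X)" if "X \<subseteq> ball 0 h" "X \<in> sets borel" for X :: "'a set"
    proof (rule emeasure_eq_ennreal_measure)
      have "emeasure lborel X \<le> emeasure lborel (ball (0::'a) h)" using that by (intro emeasure_mono) auto
      also have "\<dots> < \<infinity>" by (rule emeasure_lborel_ball_finite)
      finally show "emeasure lborel X \<noteq> top" by simp
    qed
    have bad_sub: "bad \<subseteq> ball 0 h" by (auto simp: bad_def)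
    have "ennreal ((a / 2) powr r * measure lborel bad) = (\<integral>\<^sup>+z. ennreal ((a / 2) powr r) * indicator bad z \<partial>lborel)"
      using fin[OF bad_sub bad_meas] by (simp add: nn_integral_cmult_indicator ennreal_mult')
    also have "\<dots> \<le> (\<integral>\<^sup>+z. ennreal (\<bar>w (x + z)\<bar> powr r) * indicator S' (x + z) \<partial>lborel)"
    proof (rule nn_integral_mono)
      fix z
      show "ennreal ((a / 2) powr r) * indicator bad z \<le> ennreal (\<bar>w (x + z)\<bar> powr r) * indicator S' (x + z)"
        using a r sub by (auto simp: bad_def indicator_def intro!: ennreal_leI powr_mono2)
    qed
    also have "\<dots> = (\<integral>\<^sup>+y\<in>S'. ennreal (\<bar>w y\<bar> powr r) \<partial>lborel)" by (rule nn_integral_shift) simp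
    also note A
    finally have "(a / 2) powr r * measure lborel bad \<le> A" using A0 by simp
    also have "A = (M powr r / 2 powr (r + 1)) * V" using V by (simp add: M_powr)
    also have "\<dots> \<le> (a powr r / 2 powr (r + 1)) * V"
      using a M0 r V by (intro mult_right_mono divide_right_mono powr_mono2) auto
    also have "\<dots> = (a / 2) powr r * (V / 2)" using a by (simp add: powr_divide powr_add)
    finally have bad_le: "measure lborel bad \<le> V / 2" using a by simp
    have "measure lborel (ball 0 h - bad) = V - measure lborel bad"
      unfolding V_def using bad_sub emeasure_lborel_ball_finite[of "0::'a" h]
      by (intro measure_Diff) auto
    then have good: "measure lborel (ball 0 h - bad) \<ge> V / 2" using bad_le by simp
    have "ennreal (a\<^sup>2 * V / 8) \<le> ennreal (a\<^sup>2 / 4 * measure lborel (ball 0 h - bad))"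
    proof (rule ennreal_leI)
      have "a\<^sup>2 * V / 8 = a\<^sup>2 / 4 * (V / 2)" by simp
      also have "\<dots> \<le> a\<^sup>2 / 4 * measure lborel (ball 0 h - bad)"
        by (rule mult_left_mono[OF good]) simp
      finally show "a\<^sup>2 * V / 8 \<le> a\<^sup>2 / 4 * measure lborel (ball 0 h - bad)" .
    qed
    also have "\<dots> = ennreal (a\<^sup>2 / 4) * ennreal (measure lborel (ball 0 h - bad))"
      by (rule ennreal_mult') simp
    also have "\<dots> = (\<integral>\<^sup>+z. ennreal (a\<^sup>2 / 4) * indicator (ball 0 h - bad) z \<partial>lborel)"
      using fin[of "ball 0 h - bad"] by (subst nn_integral_cmult_indicator) auto
    also have "\<dots> \<le> ?I"
    proof (rule nn_integral_mono)
      fix z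
      have "a\<^sup>2 / 4 \<le> (w (x + z) - w x)\<^sup>2" if "z \<in> ball 0 h - bad"
      proof -
        have "\<bar>w (x + z)\<bar> \<le> a / 2" using that by (auto simp: bad_def)
        then have "a / 2 \<le> \<bar>w (x + z) - w x\<bar>" unfolding a_def by linarith
        then have "(a / 2)\<^sup>2 \<le> \<bar>w (x + z) - w x\<bar>\<^sup>2" using a by (intro power_mono) auto
        then show ?thesis by (simp add: power_divide)
      qed
      then show "ennreal (a\<^sup>2 / 4) * indicator (ball 0 h - bad) z \<le>
          ennreal ((w (x + z) - w x)\<^sup>2) * indicator (ball 0 h) z"
        by (cases "z \<in> ball 0 h - bad") (auto intro: ennreal_leI)
    qed
    finally have "ennreal (8 / V) * ennreal (a\<^sup>2 * V / 8) \<le> ennreal (8 / V) * ?I"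
      by (rule mult_left_mono) simp
    moreover have "ennreal (8 / V) * ennreal (a\<^sup>2 * V / 8) = ennreal ((w x)\<^sup>2)"
      using V by (simp add: ennreal_mult'[symmetric] a_def)
    ultimately have "ennreal ((w x)\<^sup>2) \<le> ennreal (8 / V) * ?I" by simp
    then show ?thesis by (rule order_trans) simp
  qed
qed

lemma translation_interpolation:
  fixes w :: "'a::euclidean_space \<Rightarrow> real" and h r A :: real
  assumes [measurable]: "w \<in> borel_measurable borel" "S \<in> sets borel" "S' \<in> sets borel"
    and h: "h > 0" and r: "0 < r" "r \<le> 2" and A0: "A \<ge> 0"
    and sub: "\<And>x z. x \<in> S \<Longrightarrow> norm z < h \<Longrightarrow> x + z \<in> S'"
    and A: "(\<integral>\<^sup>+y\<in>S'. ennreal (\<bar>w y\<bar> powr r) \<partial>lborel) \<le> ennreal A"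
    and D: "\<And>z. norm z < h \<Longrightarrow> (\<integral>\<^sup>+x\<in>S. ennreal ((w (x + z) - w x)\<^sup>2) \<partial>lborel) \<le> D"
  shows "(\<integral>\<^sup>+x\<in>S. ennreal ((w x)\<^sup>2) \<partial>lborel) \<le> 8 * D +
    ennreal ((2 powr (r + 1) * A / measure lborel (ball (0::'a) h)) powr ((2 - r) / r)) *
      (\<integral>\<^sup>+x\<in>S. ennreal (\<bar>w x\<bar> powr r) \<partial>lborel)"
proof -
  let ?V = "measure lborel (ball (0::'a) h)"
  have V: "?V > 0" using content_ball_pos[OF h, of "0::'a"] by simp
  let ?C = "ennreal ((2 powr (r + 1) * A / ?V) powr ((2 - r) / r))"
  define B where "B = ball (0::'a) h"
  have [measurable]: "B \<in> sets borel" by (simp add: B_def)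
  let ?F = "\<lambda>x z. ennreal ((w (x + z) - w x)\<^sup>2) * indicator B z * indicator S x"
  have "(\<integral>\<^sup>+x\<in>S. ennreal ((w x)\<^sup>2) \<partial>lborel) \<le>
      (\<integral>\<^sup>+x. ennreal (8 / ?V) * (\<integral>\<^sup>+z. ?F x z \<partial>lborel) + ?C * (ennreal (\<bar>w x\<bar> powr r) * indicator S x) \<partial>lborel)"
  proof (rule nn_integral_mono)
    fix x
    show "ennreal ((w x)\<^sup>2) * indicator S x \<le>
      ennreal (8 / ?V) * (\<integral>\<^sup>+z. ?F x z \<partial>lborel) + ?C * (ennreal (\<bar>w x\<bar> powr r) * indicator S x)"
    proof (cases "x \<in> S")
      case True
      then show ?thesis
        using square_le_mean_square_increment[of w S' h r A x] sub h r A0 A by (simp add: B_def)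
    qed simp
  qed
  also have "\<dots> = ennreal (8 / ?V) * (\<integral>\<^sup>+x. (\<integral>\<^sup>+z. ?F x z \<partial>lborel) \<partial>lborel) +
      ?C * (\<integral>\<^sup>+x\<in>S. ennreal (\<bar>w x\<bar> powr r) \<partial>lborel)"
  proof -
    have [measurable]: "(\<lambda>x. \<integral>\<^sup>+z. ?F x z \<partial>lborel) \<in> borel_measurable lborel" by measurable
    have "(\<lambda>x. ?C * (ennreal (\<bar>w x\<bar> powr r) * indicator S x)) \<in> borel_measurable lborel"
      by measurable
    then show ?thesis by (subst nn_integral_add) (measurable, simp add: nn_integral_cmult)
  qed
  also have "(\<integral>\<^sup>+x. (\<integral>\<^sup>+z. ?F x z \<partial>lborel) \<partial>lborel) = (\<integral>\<^sup>+z. (\<integral>\<^sup>+x. ?F x z \<partial>lborel) \<partial>lborel)"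
    by (rule lborel_pair.Fubini'[symmetric]) simp
  also have "\<dots> \<le> (\<integral>\<^sup>+z. D * indicator B z \<partial>lborel)"
  proof (rule nn_integral_mono)
    fix z :: 'a
    show "(\<integral>\<^sup>+x. ?F x z \<partial>lborel) \<le> D * indicator B z"
      using D[of z] by (cases "z \<in> B") (auto simp: B_def)
  qed
  also have "\<dots> = D * ennreal ?V"
    using emeasure_lborel_ball_finite[of "0::'a" h]
    by (simp add: nn_integral_cmult_indicator emeasure_eq_ennreal_measure B_def)
  also have "ennreal (8 / ?V) * (D * ennreal ?V) = ennreal (8 / ?V * ?V) * D"
    using V by (subst ennreal_mult') (auto simp: mult_ac)
  also have "\<dots> = 8 * D" using V by simp
  finally show ?thesis by (simp add: add_mono mult_left_mono)
qed

text \<open>A localised Gagliardo-Nirenberg inequality with the scale \<open>h\<close> left free: when \<open>r < 2\<close>, the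
  second term is of order \<open>A\<^bsup>2/r\<^esup>\<close>, that is superlinear in the energy. This is what makes the energy
  of a minimiser vanish at a finite radius.\<close>

lemma gradient_limit_interpolation:
  fixes u :: "'a::euclidean_space \<Rightarrow> real"
  assumes lim: "gradient_limit \<phi> u g"
    and [measurable]: "S \<in> sets borel" "S' \<in> sets borel" and S: "bounded S"
    and h: "h > 0" and r: "0 < r" "r \<le> 2" and A0: "A \<ge> 0"
    and sub: "\<And>x z. x \<in> S \<Longrightarrow> norm z < h \<Longrightarrow> x + z \<in> S'"
    and A: "(\<integral>\<^sup>+y\<in>S'. ennreal (\<bar>u y\<bar> powr r) \<partial>lborel) \<le> ennreal A"
  shows "(\<integral>\<^sup>+x\<in>S. ennreal ((u x)\<^sup>2) \<partial>lborel) \<le>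
    16 * ennreal (h\<^sup>2) * (\<integral>\<^sup>+x\<in>S'. ennreal ((norm (g x))\<^sup>2) \<partial>lborel) +
    ennreal ((2 powr (r + 1) * A / measure lborel (ball (0::'a) h)) powr ((2 - r) / r)) *
      (\<integral>\<^sup>+x\<in>S. ennreal (\<bar>u x\<bar> powr r) \<partial>lborel)"
proof -
  let ?G = "\<integral>\<^sup>+x\<in>S'. ennreal ((norm (g x))\<^sup>2) \<partial>lborel"
  have [measurable]: "u \<in> borel_measurable borel" using lim by (simp add: gradient_limit_def)
  have D: "(\<integral>\<^sup>+x\<in>S. ennreal ((u (x + z) - u x)\<^sup>2) \<partial>lborel) \<le> 2 * ennreal (h\<^sup>2) * ?G"
    if z: "norm z < h" for z
  proof -
    have "x + t *\<^sub>R z \<in> S'" if "x \<in> S" "0 \<le> t" "t \<le> 1" for x t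
    proof (rule sub[OF that(1)])
      have "norm (t *\<^sub>R z) \<le> 1 * norm z" using that by (simp add: mult_left_le_one_le)
      then show "norm (t *\<^sub>R z) < h" using z by simp
    qed
    then have "(\<integral>\<^sup>+x\<in>S. ennreal ((u (x + z) - u x)\<^sup>2) \<partial>lborel) \<le> 2 * ennreal ((norm z)\<^sup>2) * ?G"
      by (intro gradient_limit_translation[OF lim _ _ S]) auto
    also have "\<dots> \<le> 2 * ennreal (h\<^sup>2) * ?G"
      using z by (intro mult_right_mono mult_left_mono ennreal_leI power_mono) auto
    finally show ?thesis .
  qed
  have "(\<integral>\<^sup>+x\<in>S. ennreal ((u x)\<^sup>2) \<partial>lborel) \<le> 8 * (2 * ennreal (h\<^sup>2) * ?G) +
    ennreal ((2 powr (r + 1) * A / measure lborel (ball (0::'a) h)) powr ((2 - r) / r)) *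
      (\<integral>\<^sup>+x\<in>S. ennreal (\<bar>u x\<bar> powr r) \<partial>lborel)"
    by (rule translation_interpolation[OF _ _ _ h r A0 sub A D]) auto
  also have "8 * (2 * ennreal (h\<^sup>2) * ?G) = 16 * ennreal (h\<^sup>2) * ?G" by (simp add: mult.assoc[symmetric])
  finally show ?thesis .
qed

text \<open>The function \<open>u - \<phi>\<^sub>n\<close> is itself a limit of the test functions \<open>\<phi>\<^sub>m - \<phi>\<^sub>n\<close>. Interpolation
  with \<open>r = 1\<close> and \<open>h = 1\<close> therefore upgrades the local \<open>L\<^sup>1\<close> convergence to local \<open>L\<^sup>2\<close> convergence.\<close>

lemma gradient_limit_L2_loc:
  fixes u :: "'a::euclidean_space \<Rightarrow> real"
  assumes lim: "gradient_limit \<phi> u g"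
  shows "(\<lambda>n. \<integral>\<^sup>+x\<in>cball 0 R. ennreal ((u x - \<phi> n x)\<^sup>2) \<partial>lborel) \<longlonglongrightarrow> 0"
proof -
  let ?A = "\<lambda>n. LINT x:cball 0 (R + 1)|lborel. \<bar>u x - \<phi> n x\<bar>"
  let ?D = "\<lambda>n. \<integral>\<^sup>+x. ennreal ((norm (g x - grad (\<phi> n) x))\<^sup>2) \<partial>lborel"
  define V where "V = measure lborel (ball (0::'a) 1)"
  have V: "V > 0" using content_ball_pos[of 1 "0::'a"] by (simp add: V_def)
  have \<phi>: "\<phi> n \<in> test_functions" for n using lim by (simp add: gradient_limit_def)
  have [measurable]: "u \<in> borel_measurable borel" "g \<in> borel_measurable borel"
    using lim by (auto simp: gradient_limit_def)
  note [measurable] = test_function_measurable[OF \<phi>]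
  have A0: "?A n \<ge> 0" for n by (simp add: set_lebesgue_integral_def)
  have A_eq: "(\<integral>\<^sup>+x\<in>cball 0 (R + 1). ennreal (\<bar>u x - \<phi> n x\<bar> powr 1) \<partial>lborel) = ennreal (?A n)" for n
  proof -
    have "set_integrable lborel (cball 0 (R + 1)) (\<lambda>x. u x - \<phi> n x)"
      using gradient_limit_diff[OF lim, of n] by (simp add: gradient_limit_def)
    then have "set_integrable lborel (cball 0 (R + 1)) (\<lambda>x. \<bar>u x - \<phi> n x\<bar>)"
      using set_integrable_abs by blast
    then have "(\<integral>\<^sup>+x. ennreal (indicator (cball 0 (R + 1)) x *\<^sub>R \<bar>u x - \<phi> n x\<bar>) \<partial>lborel) = ennreal (?A n)"
      unfolding set_integrable_def set_lebesgue_integral_def by (rule nn_integral_eq_integral) simp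
    also have "(\<integral>\<^sup>+x. ennreal (indicator (cball 0 (R + 1)) x *\<^sub>R \<bar>u x - \<phi> n x\<bar>) \<partial>lborel) =
        (\<integral>\<^sup>+x\<in>cball 0 (R + 1). ennreal (\<bar>u x - \<phi> n x\<bar> powr 1) \<partial>lborel)"
      by (intro nn_integral_cong) (auto simp: indicator_def)
    finally show ?thesis .
  qed
  have le: "(\<integral>\<^sup>+x\<in>cball 0 R. ennreal ((u x - \<phi> n x)\<^sup>2) \<partial>lborel) \<le> 16 * ?D n + ennreal (4 / V * ?A n * ?A n)" for n
  proof -
    have sub: "x + z \<in> cball 0 (R + 1)" if "x \<in> cball 0 R" "norm z < 1" for x z :: 'a
      using that norm_triangle_ineq[of x z] by simp
    have "(\<integral>\<^sup>+x\<in>cball 0 R. ennreal ((u x - \<phi> n x)\<^sup>2) \<partial>lborel) \<le>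
      16 * ennreal (1\<^sup>2) * (\<integral>\<^sup>+x\<in>cball 0 (R + 1). ennreal ((norm (g x - grad (\<phi> n) x))\<^sup>2) \<partial>lborel) +
      ennreal ((2 powr (1 + 1) * ?A n / measure lborel (ball (0::'a) 1)) powr ((2 - 1) / 1)) *
        (\<integral>\<^sup>+x\<in>cball 0 R. ennreal (\<bar>u x - \<phi> n x\<bar> powr 1) \<partial>lborel)"
      by (rule gradient_limit_interpolation[OF gradient_limit_diff[OF lim] _ _ bounded_cball _ _ _ A0 sub])
         (use A_eq[of n] in auto)
    also have "\<dots> \<le> 16 * ?D n + ennreal (4 / V * ?A n) * ennreal (?A n)"
    proof (intro add_mono mult_mono)
      show "(\<integral>\<^sup>+x\<in>cball 0 (R + 1). ennreal ((norm (g x - grad (\<phi> n) x))\<^sup>2) \<partial>lborel) \<le> ?D n"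
        by (intro nn_integral_mono) (auto simp: indicator_def)
      show "ennreal ((2 powr (1 + 1) * ?A n / measure lborel (ball (0::'a) 1)) powr ((2 - 1) / 1)) \<le> ennreal (4 / V * ?A n)"
        using A0[of n] V by (simp add: V_def[symmetric])
      show "(\<integral>\<^sup>+x\<in>cball 0 R. ennreal (\<bar>u x - \<phi> n x\<bar> powr 1) \<partial>lborel) \<le> ennreal (?A n)"
        unfolding A_eq[symmetric] by (intro nn_integral_mono) (auto simp: indicator_def)
    qed auto
    also have "ennreal (4 / V * ?A n) * ennreal (?A n) = ennreal (4 / V * ?A n * ?A n)"
      by (rule ennreal_mult'[symmetric]) (use A0[of n] V in simp)
    finally show ?thesis .
  qed
  have "(\<lambda>n. 16 * ?D n + ennreal (4 / V * ?A n * ?A n)) \<longlonglongrightarrow> 16 * 0 + ennreal (4 / V * 0 * 0)"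
    using lim by (intro tendsto_add ennreal_tendsto_cmult tendsto_ennrealI tendsto_mult tendsto_const)
      (auto simp: gradient_limit_def)
  then have lim0: "(\<lambda>n. 16 * ?D n + ennreal (4 / V * ?A n * ?A n)) \<longlonglongrightarrow> 0" by simp
  show ?thesis
    by (rule tendsto_sandwich[OF _ _ tendsto_const lim0]) (intro always_eventually allI le zero_le)+
qed

section \<open>Localisation by cut-off functions\<close>

lemma H1_dot_has_weak_gradient:
  assumes "u \<in> H1_dot"
  shows "has_weak_gradient u (weak_grad u)"
proof -
  obtain g where "has_weak_gradient u g" using assms by (auto simp: H1_dot_def)
  then show ?thesis by (rule has_weak_gradient_weak_grad)
qed

lemma H1_dot_gradient_limit:
  fixes u :: "'a::euclidean_space \<Rightarrow> real"
  assumes "u \<in> H1_dot"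
  obtains \<phi> u' g' where "gradient_limit \<phi> u' g'" "AE x in lborel. u x = u' x"
    "AE x in lborel. weak_grad u x = g' x" "integrable lborel (\<lambda>x. (norm (g' x))\<^sup>2)"
proof -
  from assms obtain \<phi> where L2: "integrable lebesgue (\<lambda>x. (norm (weak_grad u x))\<^sup>2)"
    and \<phi>: "\<And>n. \<phi> n \<in> test_functions"
    and grad_lim: "(\<lambda>n. \<integral>x. (norm (weak_grad u x - grad (\<phi> n) x))\<^sup>2 \<partial>lebesgue) \<longlonglongrightarrow> 0"
    and L1: "\<And>K. compact K \<Longrightarrow> (\<lambda>n. LINT x:K|lebesgue. \<bar>u x - \<phi> n x\<bar>) \<longlonglongrightarrow> 0"
    unfolding H1_dot_def by blast
  have loc: "loc_integrable u" "loc_integrable (weak_grad u)"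
    using H1_dot_has_weak_gradient[OF assms] by (auto simp: has_weak_gradient_def)
  obtain u' where u'[measurable]: "u' \<in> borel_measurable borel" and u_eq: "AE x in lborel. u x = u' x"
    using borel_representative[OF loc_integrable_borel_measurable[OF loc(1)]] by blast
  obtain g' where g'[measurable]: "g' \<in> borel_measurable borel" and g_eq: "AE x in lborel. weak_grad u x = g' x"
    using borel_representative[OF loc_integrable_borel_measurable[OF loc(2)]] by blast
  note [measurable] = test_function_measurable[OF \<phi>] loc_integrable_borel_measurable[OF loc(1)]
    loc_integrable_borel_measurable[OF loc(2)]
  note leb = borel_measurable_imp_lebesgue
  note [measurable] = leb[OF u'] leb[OF g'] leb[OF test_function_measurable(1)[OF \<phi>]]
    leb[OF test_function_measurable(2)[OF \<phi>]]
  have "integrable lebesgue (\<lambda>x. (norm (g' x))\<^sup>2)"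
    by (rule integrable_cong_AE_imp[OF L2])
       (use g_eq in \<open>auto simp: AE_lebesgue_iff elim: eventually_mono\<close>)
  then have g'_L2: "integrable lborel (\<lambda>x. (norm (g' x))\<^sup>2)" by (simp add: integrable_completion)
  have grad_L2: "integrable lborel (\<lambda>x. (norm (grad (\<phi> n) x))\<^sup>2)" for n
  proof -
    let ?K = "closure {x. \<phi> n x \<noteq> 0}"
    have "compact ?K" using \<phi>[of n] by (simp add: test_functions_def)
    then have "integrable lborel (\<lambda>x. indicator ?K x *\<^sub>R (norm (grad (\<phi> n) x))\<^sup>2)"
      by (rule borel_integrable_compact)
         (intro continuous_intros continuous_on_subset[OF test_function_continuous(2)[OF \<phi>]] subset_UNIV)
    also have "(\<lambda>x. indicator ?K x *\<^sub>R (norm (grad (\<phi> n) x))\<^sup>2) = (\<lambda>x. (norm (grad (\<phi> n) x))\<^sup>2)"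
    proof
      fix x
      show "indicator ?K x *\<^sub>R (norm (grad (\<phi> n) x))\<^sup>2 = (norm (grad (\<phi> n) x))\<^sup>2"
        using grad_eq_0_outside[OF \<phi>, of x n] by (cases "x \<in> ?K") auto
    qed
    finally show ?thesis .
  qed
  have "gradient_limit \<phi> u' g'"
    unfolding gradient_limit_def
  proof (intro conjI allI u' g' \<phi>)
    have "(\<integral>\<^sup>+x. ennreal ((norm (g' x - grad (\<phi> n) x))\<^sup>2) \<partial>lborel) =
        ennreal (\<integral>x. (norm (weak_grad u x - grad (\<phi> n) x))\<^sup>2 \<partial>lebesgue)" for n
    proof -
      have bound: "(norm (g' x - grad (\<phi> n) x))\<^sup>2 \<le> 2 * (norm (g' x))\<^sup>2 + 2 * (norm (grad (\<phi> n) x))\<^sup>2" for x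
        using ennreal_square_add_le[of "g' x" "- grad (\<phi> n) x"]
        by (simp add: ennreal_mult'[symmetric] ennreal_plus[symmetric] flip: ennreal_numeral del: ennreal_plus)
      have "integrable lborel (\<lambda>x. (norm (g' x - grad (\<phi> n) x))\<^sup>2)"
      proof (rule Bochner_Integration.integrable_bound)
        show "integrable lborel (\<lambda>x. 2 * (norm (g' x))\<^sup>2 + 2 * (norm (grad (\<phi> n) x))\<^sup>2)"
          using g'_L2 grad_L2 by simp
      qed (use bound in auto)
      then have "(\<integral>\<^sup>+x. ennreal ((norm (g' x - grad (\<phi> n) x))\<^sup>2) \<partial>lborel) =
          ennreal (\<integral>x. (norm (g' x - grad (\<phi> n) x))\<^sup>2 \<partial>lborel)"
        by (rule nn_integral_eq_integral) simp
      also have "(\<integral>x. (norm (g' x - grad (\<phi> n) x))\<^sup>2 \<partial>lborel) = (\<integral>x. (norm (g' x - grad (\<phi> n) x))\<^sup>2 \<partial>lebesgue)"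
        by (simp add: integral_completion)
      also have "\<dots> = (\<integral>x. (norm (weak_grad u x - grad (\<phi> n) x))\<^sup>2 \<partial>lebesgue)"
        by (rule integral_cong_AE) (use g_eq in \<open>auto simp: AE_lebesgue_iff elim: eventually_mono\<close>)
      finally show ?thesis .
    qed
    then show "(\<lambda>n. \<integral>\<^sup>+x. ennreal ((norm (g' x - grad (\<phi> n) x))\<^sup>2) \<partial>lborel) \<longlonglongrightarrow> 0"
      using tendsto_ennrealI[OF grad_lim] by simp
    fix R :: real
    define Q where "Q = cball (0::'a) R"
    have [measurable]: "Q \<in> sets borel" "Q \<in> sets lebesgue" by (simp_all add: Q_def)
    have "set_integrable lebesgue Q u" using loc(1) by (simp add: loc_integrable_def Q_def)
    moreover have "(\<lambda>x. indicat_real Q x *\<^sub>R u' x) \<in> borel_measurable lebesgue"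
      by (rule leb) simp
    ultimately have "integrable lebesgue (\<lambda>x. indicator Q x *\<^sub>R u' x)"
      unfolding set_integrable_def
      by (rule integrable_cong_AE_imp) (use u_eq in \<open>auto simp: AE_lebesgue_iff elim: eventually_mono\<close>)
    then show "set_integrable lborel (cball 0 R) u'"
      unfolding Q_def[symmetric] by (simp add: integrable_completion set_integrable_def)
    have "(LINT x:Q|lborel. \<bar>u' x - \<phi> n x\<bar>) = (LINT x:Q|lebesgue. \<bar>u x - \<phi> n x\<bar>)" for n
    proof -
      have "(LINT x:Q|lborel. \<bar>u' x - \<phi> n x\<bar>) = (LINT x:Q|lebesgue. \<bar>u' x - \<phi> n x\<bar>)"
        unfolding set_lebesgue_integral_def by (rule integral_completion[symmetric]) simp
      also have "\<dots> = (LINT x:Q|lebesgue. \<bar>u x - \<phi> n x\<bar>)"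
        unfolding set_lebesgue_integral_def
        by (rule integral_cong_AE) (use u_eq in \<open>auto simp: AE_lebesgue_iff elim: eventually_mono\<close>)
      finally show ?thesis .
    qed
    then show "(\<lambda>n. LINT x:cball 0 R|lborel. \<bar>u' x - \<phi> n x\<bar>) \<longlonglongrightarrow> 0"
      using L1[OF compact_cball, of 0 R] by (simp add: Q_def)
  qed
  then show thesis using that u_eq g_eq g'_L2 by blast
qed

lemma loc_integrable_bounded_mult:
  fixes u :: "'a::euclidean_space \<Rightarrow> 'b::euclidean_space" and G :: "'a \<Rightarrow> 'c::euclidean_space"
    and B :: "'b \<Rightarrow> 'c \<Rightarrow> 'd::euclidean_space"
  assumes u: "loc_integrable u" and G: "G \<in> borel_measurable borel" "\<And>x. norm (G x) \<le> C"
    and B: "bounded_bilinear B"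
  shows "loc_integrable (\<lambda>x. B (u x) (G x))"
proof -
  interpret bounded_bilinear B by (rule B)
  obtain k where k: "k > 0" "\<And>a b. norm (B a b) \<le> norm a * norm b * k" using pos_bounded by blast
  have C: "C \<ge> 0" using G(2)[of undefined] norm_ge_zero order_trans by blast
  have *: "set_integrable lebesgue K (\<lambda>x. B (u x) (G x))" if u: "set_integrable lebesgue K u" for K
  proof -
    have eq: "indicator K x *\<^sub>R B (u x) (G x) = B (indicator K x *\<^sub>R u x) (G x)" for x
      by (simp add: scaleR_left)
    have m: "(\<lambda>x. indicator K x *\<^sub>R u x) \<in> borel_measurable lebesgue"
      using u unfolding set_integrable_def by (rule borel_measurable_integrable)
    show ?thesis
      unfolding set_integrable_def eq
    proof (rule Bochner_Integration.integrable_bound)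
      show "integrable lebesgue (\<lambda>x. (C * k) *\<^sub>R (indicator K x *\<^sub>R u x))"
        using u unfolding set_integrable_def by (rule integrable_scaleR_right)
      show "(\<lambda>x. B (indicator K x *\<^sub>R u x) (G x)) \<in> borel_measurable lebesgue"
        using bounded_bilinear.continuous_on[OF B continuous_on_fst[OF continuous_on_id] continuous_on_snd[OF continuous_on_id], of UNIV]
        by (intro borel_measurable_continuous_Pair[OF m borel_measurable_imp_lebesgue[OF G(1)]]) simp
      show "AE x in lebesgue. norm (B (indicat_real K x *\<^sub>R u x) (G x)) \<le> norm ((C * k) *\<^sub>R (indicat_real K x *\<^sub>R u x))"
      proof (rule AE_I2)
        fix x
        let ?v = "indicat_real K x *\<^sub>R u x"
        have "norm (B ?v (G x)) \<le> norm ?v * norm (G x) * k" by (rule k(2))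
        also have "\<dots> \<le> norm ?v * C * k"
          using k(1) G(2) by (intro mult_right_mono mult_left_mono) auto
        finally show "norm (B ?v (G x)) \<le> norm ((C * k) *\<^sub>R ?v)"
          using C k(1) by (simp add: mult_ac)
      qed
    qed
  qed
  then show ?thesis using u unfolding loc_integrable_def by blast
qed

text \<open>The product rule follows from testing the weak gradient of \<open>u\<close> with \<open>\<eta> \<psi>\<close>.\<close>

lemma weak_gradient_product:
  fixes u :: "'a::euclidean_space \<Rightarrow> real"
  assumes w: "has_weak_gradient u g" and \<eta>: "\<eta> \<in> test_functions"
  shows "has_weak_gradient (\<lambda>x. \<eta> x * u x) (\<lambda>x. \<eta> x *\<^sub>R g x + u x *\<^sub>R grad \<eta> x)"
proof -
  have u: "loc_integrable u" and g: "loc_integrable g" using w by (auto simp: has_weak_gradient_def)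
  have mult_u: "loc_integrable (\<lambda>x. u x * \<psi> x)" if \<psi>: "\<psi> \<in> test_functions" for \<psi> :: "'a \<Rightarrow> real"
  proof -
    obtain C where "\<And>x. \<bar>\<psi> x\<bar> \<le> C" by (rule test_function_bounded[OF \<psi>]) blast
    then have C: "norm (\<psi> x) \<le> C" for x by simp
    show ?thesis
      by (rule loc_integrable_bounded_mult[OF u test_function_measurable(1)[OF \<psi>] C bounded_bilinear_mult])
  qed
  have mult_grad: "loc_integrable (\<lambda>x. u x *\<^sub>R grad \<psi> x)" if \<psi>: "\<psi> \<in> test_functions" for \<psi> :: "'a \<Rightarrow> real"
  proof -
    obtain C where C: "\<And>x. norm (grad \<psi> x) \<le> C" by (rule test_function_bounded[OF \<psi>]) blast
    show ?thesis
      by (rule loc_integrable_bounded_mult[OF u test_function_measurable(2)[OF \<psi>] C bounded_bilinear_scaleR])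
  qed
  have mult_g: "loc_integrable (\<lambda>x. \<eta> x *\<^sub>R g x)"
  proof -
    obtain C where "\<And>x. \<bar>\<eta> x\<bar> \<le> C" by (rule test_function_bounded[OF \<eta>]) blast
    then have C: "norm (\<eta> x) \<le> C" for x by simp
    show ?thesis
      by (rule loc_integrable_bounded_mult[OF g test_function_measurable(1)[OF \<eta>] C
            bounded_bilinear.flip[OF bounded_bilinear_scaleR]])
  qed
  have int_grad: "integrable lebesgue (\<lambda>x. u x *\<^sub>R grad \<psi> x)" if \<psi>: "\<psi> \<in> test_functions" for \<psi> :: "'a \<Rightarrow> real"
  proof -
    let ?K = "closure {x. \<psi> x \<noteq> 0}"
    have "compact ?K" using \<psi> by (simp add: test_functions_def)
    then have "integrable lebesgue (\<lambda>x. indicator ?K x *\<^sub>R (u x *\<^sub>R grad \<psi> x))"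
      using mult_grad[OF \<psi>] unfolding loc_integrable_def set_integrable_def by blast
    also have "(\<lambda>x. indicator ?K x *\<^sub>R (u x *\<^sub>R grad \<psi> x)) = (\<lambda>x. u x *\<^sub>R grad \<psi> x)"
    proof
      fix x
      show "indicator ?K x *\<^sub>R (u x *\<^sub>R grad \<psi> x) = u x *\<^sub>R grad \<psi> x"
        using grad_eq_0_outside[OF \<psi>, of x] by (cases "x \<in> ?K") auto
    qed
    finally show ?thesis .
  qed
  show ?thesis
    unfolding has_weak_gradient_def
  proof (intro conjI ballI)
    show "loc_integrable (\<lambda>x. \<eta> x * u x)" using mult_u[OF \<eta>] by (simp add: mult.commute)
    show "loc_integrable (\<lambda>x. \<eta> x *\<^sub>R g x + u x *\<^sub>R grad \<eta> x)"
      unfolding loc_integrable_def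
    proof (intro allI impI)
      fix K :: "'a set" assume K: "compact K"
      show "set_integrable lebesgue K (\<lambda>x. \<eta> x *\<^sub>R g x + u x *\<^sub>R grad \<eta> x)"
        using mult_g mult_grad[OF \<eta>] K unfolding loc_integrable_def by (intro set_integral_add(1)) blast+
    qed
    fix \<psi> :: "'a \<Rightarrow> real" assume \<psi>: "\<psi> \<in> test_functions"
    note \<eta>\<psi> = test_function_mult[OF \<eta> \<psi>]
    have i1: "integrable lebesgue (\<lambda>x. u x *\<^sub>R grad (\<lambda>x. \<eta> x * \<psi> x) x)"
      by (rule int_grad[OF \<eta>\<psi>(1)])
    have i2: "integrable lebesgue (\<lambda>x. \<psi> x *\<^sub>R (u x *\<^sub>R grad \<eta> x))"
      by (rule integrable_test_function_scaleR[OF mult_grad[OF \<eta>] \<psi>])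
    have i3: "integrable lebesgue (\<lambda>x. \<psi> x *\<^sub>R (\<eta> x *\<^sub>R g x))"
      by (rule integrable_test_function_scaleR[OF mult_g \<psi>])
    have "(\<integral>x. (\<eta> x * u x) *\<^sub>R grad \<psi> x \<partial>lebesgue) =
        (\<integral>x. u x *\<^sub>R grad (\<lambda>x. \<eta> x * \<psi> x) x - \<psi> x *\<^sub>R (u x *\<^sub>R grad \<eta> x) \<partial>lebesgue)"
      by (intro Bochner_Integration.integral_cong refl) (simp add: \<eta>\<psi>(2) algebra_simps)
    also have "\<dots> = (\<integral>x. u x *\<^sub>R grad (\<lambda>x. \<eta> x * \<psi> x) x \<partial>lebesgue) - (\<integral>x. \<psi> x *\<^sub>R (u x *\<^sub>R grad \<eta> x) \<partial>lebesgue)"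
      by (rule Bochner_Integration.integral_diff[OF i1 i2])
    also have "(\<integral>x. u x *\<^sub>R grad (\<lambda>x. \<eta> x * \<psi> x) x \<partial>lebesgue) = - (\<integral>x. (\<eta> x * \<psi> x) *\<^sub>R g x \<partial>lebesgue)"
      using w \<eta>\<psi>(1) unfolding has_weak_gradient_def by blast
    also have "(\<integral>x. (\<eta> x * \<psi> x) *\<^sub>R g x \<partial>lebesgue) = (\<integral>x. \<psi> x *\<^sub>R (\<eta> x *\<^sub>R g x) \<partial>lebesgue)"
      by (simp add: mult.commute)
    also have "- (\<integral>x. \<psi> x *\<^sub>R (\<eta> x *\<^sub>R g x) \<partial>lebesgue) - (\<integral>x. \<psi> x *\<^sub>R (u x *\<^sub>R grad \<eta> x) \<partial>lebesgue) =
        - (\<integral>x. \<psi> x *\<^sub>R (\<eta> x *\<^sub>R g x) + \<psi> x *\<^sub>R (u x *\<^sub>R grad \<eta> x) \<partial>lebesgue)"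
      unfolding Bochner_Integration.integral_add[OF i3 i2]
      by (simp only: minus_add_distrib diff_conv_add_uminus)
    also have "\<dots> = - (\<integral>x. \<psi> x *\<^sub>R (\<eta> x *\<^sub>R g x + u x *\<^sub>R grad \<eta> x) \<partial>lebesgue)"
      by (simp only: scaleR_add_right)
    finally show "(\<integral>x. (\<eta> x * u x) *\<^sub>R grad \<psi> x \<partial>lebesgue) =
        - (\<integral>x. \<psi> x *\<^sub>R (\<eta> x *\<^sub>R g x + u x *\<^sub>R grad \<eta> x) \<partial>lebesgue)" .
  qed
qed

lemma nn_square_integral_cball_finite:
  fixes u :: "'a::euclidean_space \<Rightarrow> real"
  assumes lim: "gradient_limit \<phi> u g"
  shows "(\<integral>\<^sup>+x\<in>cball 0 R. ennreal ((u x)\<^sup>2) \<partial>lborel) < \<infinity>"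
proof -
  have \<phi>: "\<phi> n \<in> test_functions" for n using lim by (simp add: gradient_limit_def)
  have [measurable]: "u \<in> borel_measurable borel" using lim by (auto simp: gradient_limit_def)
  note [measurable] = test_function_measurable(1)[OF \<phi>]
  define Q where "Q = cball (0::'a) R"
  have [measurable]: "Q \<in> sets borel" by (simp add: Q_def)
  have "eventually (\<lambda>n. (\<integral>\<^sup>+x\<in>Q. ennreal ((u x - \<phi> n x)\<^sup>2) \<partial>lborel) < 1) sequentially"
    using order_tendstoD(2)[OF gradient_limit_L2_loc[OF lim, of R], of 1] by (simp add: Q_def)
  then obtain n where n: "(\<integral>\<^sup>+x\<in>Q. ennreal ((u x - \<phi> n x)\<^sup>2) \<partial>lborel) < 1"
    by (auto simp: eventually_sequentially)
  obtain C where C: "\<And>x. \<bar>\<phi> n x\<bar> \<le> C" by (rule test_function_bounded[OF \<phi>[of n]]) blast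
  have "(\<integral>\<^sup>+x\<in>Q. ennreal ((u x)\<^sup>2) \<partial>lborel) \<le>
      (\<integral>\<^sup>+x. 2 * (ennreal ((u x - \<phi> n x)\<^sup>2) * indicator Q x) + ennreal (2 * C\<^sup>2) * indicator Q x \<partial>lborel)"
  proof (rule nn_integral_mono)
    fix x
    have "(\<phi> n x)\<^sup>2 \<le> C\<^sup>2" using C[of x] by (simp add: abs_le_square_iff[symmetric])
    have "ennreal ((u x)\<^sup>2) \<le> 2 * ennreal ((u x - \<phi> n x)\<^sup>2) + 2 * ennreal ((\<phi> n x)\<^sup>2)"
      using ennreal_square_add_le[of "u x - \<phi> n x" "\<phi> n x"] by simp
    also have "\<dots> \<le> 2 * ennreal ((u x - \<phi> n x)\<^sup>2) + 2 * ennreal (C\<^sup>2)"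
      using \<open>(\<phi> n x)\<^sup>2 \<le> C\<^sup>2\<close> by (intro add_left_mono mult_left_mono ennreal_leI) auto
    also have "2 * ennreal (C\<^sup>2) = ennreal (2 * C\<^sup>2)" by (simp add: ennreal_mult')
    finally show "ennreal ((u x)\<^sup>2) * indicator Q x \<le>
        2 * (ennreal ((u x - \<phi> n x)\<^sup>2) * indicator Q x) + ennreal (2 * C\<^sup>2) * indicator Q x"
      by (cases "x \<in> Q") auto
  qed
  also have "\<dots> = 2 * (\<integral>\<^sup>+x\<in>Q. ennreal ((u x - \<phi> n x)\<^sup>2) \<partial>lborel) + ennreal (2 * C\<^sup>2) * emeasure lborel Q"
    by (simp add: nn_integral_add nn_integral_cmult nn_integral_cmult_indicator)
  also have "\<dots> < \<infinity>"
  proof -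
    have "emeasure lborel Q < \<infinity>" unfolding Q_def by (rule emeasure_lborel_cball_finite)
    moreover have "(\<integral>\<^sup>+x\<in>Q. ennreal ((u x - \<phi> n x)\<^sup>2) \<partial>lborel) < \<infinity>"
      using n by (rule less_trans) simp
    ultimately show ?thesis by (simp add: ennreal_mult_less_top ennreal_add_less_top)
  qed
  finally show ?thesis by (simp add: Q_def)
qed

lemma nn_norm_square_product_le:
  fixes v :: "'a::euclidean_space \<Rightarrow> real" and G :: "'a \<Rightarrow> 'a"
  assumes [measurable]: "v \<in> borel_measurable borel" "G \<in> borel_measurable borel"
    and \<eta>: "\<eta> \<in> test_functions"
    and C: "\<And>x. \<bar>\<eta> x\<bar> \<le> C" "\<And>x. norm (grad \<eta> x) \<le> C"
    and R: "\<And>x. grad \<eta> x \<noteq> 0 \<Longrightarrow> x \<in> cball 0 R"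
  shows "(\<integral>\<^sup>+x. ennreal ((norm (\<eta> x *\<^sub>R G x + v x *\<^sub>R grad \<eta> x))\<^sup>2) \<partial>lborel) \<le>
    ennreal (2 * C\<^sup>2) * (\<integral>\<^sup>+x. ennreal ((norm (G x))\<^sup>2) \<partial>lborel) +
    ennreal (2 * C\<^sup>2) * (\<integral>\<^sup>+x\<in>cball 0 R. ennreal ((v x)\<^sup>2) \<partial>lborel)"
proof -
  define Q where "Q = cball (0::'a) R"
  have [measurable]: "Q \<in> sets borel" by (simp add: Q_def)
  have C0: "C \<ge> 0" using C(1)[of 0] by linarith
  have "(\<integral>\<^sup>+x. ennreal ((norm (\<eta> x *\<^sub>R G x + v x *\<^sub>R grad \<eta> x))\<^sup>2) \<partial>lborel) \<le>
    (\<integral>\<^sup>+x. ennreal (2 * C\<^sup>2) * ennreal ((norm (G x))\<^sup>2) +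
      ennreal (2 * C\<^sup>2) * (ennreal ((v x)\<^sup>2) * indicator Q x) \<partial>lborel)"
  proof (rule nn_integral_mono)
    fix x
    have 1: "ennreal ((norm (\<eta> x *\<^sub>R G x))\<^sup>2) \<le> ennreal (C\<^sup>2) * ennreal ((norm (G x))\<^sup>2)"
    proof -
      have "(norm (\<eta> x *\<^sub>R G x))\<^sup>2 \<le> (C * norm (G x))\<^sup>2"
        using C(1)[of x] by (intro power_mono) (auto intro: mult_right_mono)
      then show ?thesis by (simp add: power_mult_distrib ennreal_mult'[symmetric] ennreal_leI)
    qed
    have 2: "ennreal ((norm (v x *\<^sub>R grad \<eta> x))\<^sup>2) \<le> ennreal (C\<^sup>2) * (ennreal ((v x)\<^sup>2) * indicator Q x)"
    proof (cases "grad \<eta> x = 0")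
      case False
      have "(norm (v x *\<^sub>R grad \<eta> x))\<^sup>2 \<le> (\<bar>v x\<bar> * C)\<^sup>2"
        using C(2)[of x] by (intro power_mono) (auto intro: mult_left_mono)
      then show ?thesis using R[OF False]
        by (simp add: Q_def power_mult_distrib ennreal_mult'[symmetric] ennreal_leI mult.commute)
    qed simp
    have "ennreal ((norm (\<eta> x *\<^sub>R G x + v x *\<^sub>R grad \<eta> x))\<^sup>2) \<le>
        2 * (ennreal (C\<^sup>2) * ennreal ((norm (G x))\<^sup>2)) + 2 * (ennreal (C\<^sup>2) * (ennreal ((v x)\<^sup>2) * indicator Q x))"
      by (rule order_trans[OF ennreal_square_add_le]) (intro add_mono mult_left_mono 1 2 zero_le)
    then show "ennreal ((norm (\<eta> x *\<^sub>R G x + v x *\<^sub>R grad \<eta> x))\<^sup>2) \<le>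
        ennreal (2 * C\<^sup>2) * ennreal ((norm (G x))\<^sup>2) +
        ennreal (2 * C\<^sup>2) * (ennreal ((v x)\<^sup>2) * indicator Q x)"
      by (simp add: ennreal_mult' mult.assoc)
  qed
  also have "\<dots> = ennreal (2 * C\<^sup>2) * (\<integral>\<^sup>+x. ennreal ((norm (G x))\<^sup>2) \<partial>lborel) +
    ennreal (2 * C\<^sup>2) * (\<integral>\<^sup>+x\<in>Q. ennreal ((v x)\<^sup>2) \<partial>lborel)"
    by (simp add: nn_integral_add nn_integral_cmult)
  finally show ?thesis by (simp add: Q_def)
qed

text \<open>The products \<open>\<phi>\<^sub>n \<eta>\<close> approximate \<open>\<eta> u\<close>. Their gradients contain the term
  \<open>\<phi>\<^sub>n \<nabla>\<eta>\<close>, which converges in \<open>L\<^sup>2\<close> only because the \<open>\<phi>\<^sub>n\<close> converge locally in \<open>L\<^sup>2\<close>.\<close>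

lemma H1_dot_product:
  fixes u :: "'a::euclidean_space \<Rightarrow> real"
  assumes u: "u \<in> H1_dot" and \<eta>: "\<eta> \<in> test_functions"
  shows "(\<lambda>x. \<eta> x * u x) \<in> H1_dot"
    and "AE x in lebesgue. weak_grad (\<lambda>x. \<eta> x * u x) x = \<eta> x *\<^sub>R weak_grad u x + u x *\<^sub>R grad \<eta> x"
proof -
  let ?v = "\<lambda>x. \<eta> x * u x"
  have wu: "has_weak_gradient u (weak_grad u)" by (rule H1_dot_has_weak_gradient[OF u])
  note wv = weak_gradient_product[OF wu \<eta>]
  have wv': "has_weak_gradient ?v (weak_grad ?v)" by (rule has_weak_gradient_weak_grad[OF wv])
  show eq: "AE x in lebesgue. weak_grad ?v x = \<eta> x *\<^sub>R weak_grad u x + u x *\<^sub>R grad \<eta> x"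
    by (rule weak_grad_AE_eq[OF wv])
  obtain \<phi> u' g' where lim: "gradient_limit \<phi> u' g'" and ueq: "AE x in lborel. u x = u' x"
    and geq: "AE x in lborel. weak_grad u x = g' x" and L2: "integrable lborel (\<lambda>x. (norm (g' x))\<^sup>2)"
    by (rule H1_dot_gradient_limit[OF u])
  have \<phi>: "\<phi> n \<in> test_functions" for n using lim by (simp add: gradient_limit_def)
  have bu[measurable]: "u' \<in> borel_measurable borel" and bg[measurable]: "g' \<in> borel_measurable borel"
    using lim by (auto simp: gradient_limit_def)
  note [measurable] = test_function_measurable[OF \<phi>] test_function_measurable[OF \<eta>]
  have loc: "loc_integrable u" "loc_integrable (weak_grad ?v)"
    using wu wv' by (auto simp: has_weak_gradient_def)
  obtain C where C: "\<And>x. \<bar>\<eta> x\<bar> \<le> C" "\<And>x. norm (grad \<eta> x) \<le> C" by (rule test_function_bounded[OF \<eta>]) blast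
  have C0: "C \<ge> 0" using C(1)[of 0] by linarith
  obtain R where R: "\<And>x. grad \<eta> x \<noteq> 0 \<Longrightarrow> x \<in> cball 0 R"
  proof -
    have "bounded (closure {x. \<eta> x \<noteq> 0})" by (rule bounded_closure[OF test_functionsD(2)[OF \<eta>]])
    then obtain R where R: "\<forall>x\<in>closure {x. \<eta> x \<noteq> 0}. norm x \<le> R" unfolding bounded_iff by blast
    show thesis
    proof (rule that)
      fix x assume "grad \<eta> x \<noteq> 0"
      then have "x \<in> closure {x. \<eta> x \<noteq> 0}" using grad_eq_0_outside[OF \<eta>] by blast
      from bspec[OF R this] show "x \<in> cball 0 R" by simp
    qed
  qed
  have weq: "AE x in lborel. weak_grad ?v x = \<eta> x *\<^sub>R g' x + u' x *\<^sub>R grad \<eta> x"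
    using eq[unfolded AE_lebesgue_iff] ueq geq by eventually_elim simp
  have wv_meas: "weak_grad ?v \<in> borel_measurable lebesgue"
    by (rule loc_integrable_borel_measurable[OF loc(2)])
  have integral_eq: "(\<integral>x. (norm (weak_grad ?v x - grad (\<lambda>x. \<psi> x * \<eta> x) x))\<^sup>2 \<partial>lebesgue) =
      enn2real (\<integral>\<^sup>+x. ennreal ((norm (\<eta> x *\<^sub>R (g' x - grad \<psi> x) + (u' x - \<psi> x) *\<^sub>R grad \<eta> x))\<^sup>2) \<partial>lborel)"
    if \<psi>: "\<psi> \<in> test_functions" for \<psi>
  proof -
    note m = test_function_mult[OF \<psi> \<eta>]
    have "(\<integral>x. (norm (weak_grad ?v x - grad (\<lambda>x. \<psi> x * \<eta> x) x))\<^sup>2 \<partial>lebesgue) =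
        enn2real (\<integral>\<^sup>+x. ennreal ((norm (weak_grad ?v x - grad (\<lambda>x. \<psi> x * \<eta> x) x))\<^sup>2) \<partial>lebesgue)"
      using wv_meas borel_measurable_imp_lebesgue[OF test_function_measurable(2)[OF m(1)]]
      by (intro integral_eq_nn_integral) auto
    also have "(\<integral>\<^sup>+x. ennreal ((norm (weak_grad ?v x - grad (\<lambda>x. \<psi> x * \<eta> x) x))\<^sup>2) \<partial>lebesgue) =
      (\<integral>\<^sup>+x. ennreal ((norm (\<eta> x *\<^sub>R (g' x - grad \<psi> x) + (u' x - \<psi> x) *\<^sub>R grad \<eta> x))\<^sup>2) \<partial>lborel)"
      unfolding nn_integral_completion
    proof (rule nn_integral_cong_AE)
      show "AE x in lborel. ennreal ((norm (weak_grad ?v x - grad (\<lambda>x. \<psi> x * \<eta> x) x))\<^sup>2) =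
          ennreal ((norm (\<eta> x *\<^sub>R (g' x - grad \<psi> x) + (u' x - \<psi> x) *\<^sub>R grad \<eta> x))\<^sup>2)"
        using weq
      proof eventually_elim
        case (elim x)
        have "weak_grad ?v x - grad (\<lambda>x. \<psi> x * \<eta> x) x =
            \<eta> x *\<^sub>R (g' x - grad \<psi> x) + (u' x - \<psi> x) *\<^sub>R grad \<eta> x"
          unfolding elim m(2) by (simp add: algebra_simps)
        then show ?case by (rule arg_cong)
      qed
    qed
    finally show ?thesis .
  qed
  have bound: "(\<integral>\<^sup>+x. ennreal ((norm (\<eta> x *\<^sub>R (g' x - grad \<psi> x) + (u' x - \<psi> x) *\<^sub>R grad \<eta> x))\<^sup>2) \<partial>lborel) \<le>
      ennreal (2 * C\<^sup>2) * (\<integral>\<^sup>+x. ennreal ((norm (g' x - grad \<psi> x))\<^sup>2) \<partial>lborel) +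
      ennreal (2 * C\<^sup>2) * (\<integral>\<^sup>+x\<in>cball 0 R. ennreal ((u' x - \<psi> x)\<^sup>2) \<partial>lborel)"
    if \<psi>: "\<psi> \<in> test_functions" for \<psi>
    using test_function_measurable[OF \<psi>]
    by (intro nn_norm_square_product_le[OF _ _ \<eta> C R] borel_measurable_diff bu bg)
  have zero: "(\<lambda>x. 0::real) \<in> test_functions" by (rule test_functionsI) (auto intro: Ck_const)
  have grad_zero: "grad (\<lambda>x. 0::real) = (\<lambda>x::'a. 0)"
    by (rule ext, rule grad_eqI) simp
  have int_v: "integrable lebesgue (\<lambda>x. (norm (weak_grad ?v x))\<^sup>2)"
  proof (rule integrableI_bounded)
    show "(\<lambda>x. (norm (weak_grad ?v x))\<^sup>2) \<in> borel_measurable lebesgue" using wv_meas by simp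
    have "(\<integral>\<^sup>+x. ennreal (norm ((norm (weak_grad ?v x))\<^sup>2)) \<partial>lebesgue) =
        (\<integral>\<^sup>+x. ennreal ((norm (\<eta> x *\<^sub>R g' x + u' x *\<^sub>R grad \<eta> x))\<^sup>2) \<partial>lborel)"
      unfolding nn_integral_completion
      by (rule nn_integral_cong_AE) (use weq in \<open>eventually_elim, simp\<close>)
    also have "\<dots> \<le> ennreal (2 * C\<^sup>2) * (\<integral>\<^sup>+x. ennreal ((norm (g' x))\<^sup>2) \<partial>lborel) +
      ennreal (2 * C\<^sup>2) * (\<integral>\<^sup>+x\<in>cball 0 R. ennreal ((u' x)\<^sup>2) \<partial>lborel)"
      using bound[OF zero] by (simp add: grad_zero)
    also have "\<dots> < \<infinity>"
    proof -
      have "(\<integral>\<^sup>+x. ennreal ((norm (g' x))\<^sup>2) \<partial>lborel) < \<infinity>"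
        using L2 by (simp add: nn_integral_eq_integral)
      then show ?thesis using nn_square_integral_cball_finite[OF lim, of R]
        by (simp add: ennreal_mult_less_top ennreal_add_less_top)
    qed
    finally show "(\<integral>\<^sup>+x. ennreal (norm ((norm (weak_grad ?v x))\<^sup>2)) \<partial>lebesgue) < \<infinity>" .
  qed
  have conv: "(\<lambda>n. \<integral>x. (norm (weak_grad ?v x - grad (\<lambda>x. \<phi> n x * \<eta> x) x))\<^sup>2 \<partial>lebesgue) \<longlonglongrightarrow> 0"
  proof -
    let ?b = "\<lambda>n. ennreal (2 * C\<^sup>2) * (\<integral>\<^sup>+x. ennreal ((norm (g' x - grad (\<phi> n) x))\<^sup>2) \<partial>lborel) +
      ennreal (2 * C\<^sup>2) * (\<integral>\<^sup>+x\<in>cball 0 R. ennreal ((u' x - \<phi> n x)\<^sup>2) \<partial>lborel)"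
    have "?b \<longlonglongrightarrow> ennreal (2 * C\<^sup>2) * 0 + ennreal (2 * C\<^sup>2) * 0"
      using lim gradient_limit_L2_loc[OF lim, of R]
      by (intro tendsto_add ennreal_tendsto_cmult) (auto simp: gradient_limit_def)
    then have b: "?b \<longlonglongrightarrow> 0" by simp
    have "(\<lambda>n. \<integral>\<^sup>+x. ennreal ((norm (\<eta> x *\<^sub>R (g' x - grad (\<phi> n) x) + (u' x - \<phi> n x) *\<^sub>R grad \<eta> x))\<^sup>2) \<partial>lborel) \<longlonglongrightarrow> 0"
      by (rule tendsto_sandwich[OF _ _ tendsto_const b]) (intro always_eventually allI bound[OF \<phi>] zero_le)+
    then have "(\<lambda>n. enn2real (\<integral>\<^sup>+x. ennreal ((norm (\<eta> x *\<^sub>R (g' x - grad (\<phi> n) x) + (u' x - \<phi> n x) *\<^sub>R grad \<eta> x))\<^sup>2) \<partial>lborel)) \<longlonglongrightarrow> 0"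
      by (intro tendsto_enn2real) simp_all
    then show ?thesis by (simp only: integral_eq[OF \<phi>])
  qed
  have L1: "(\<lambda>n. LINT x:K|lebesgue. \<bar>?v x - \<phi> n x * \<eta> x\<bar>) \<longlonglongrightarrow> 0" if K: "compact K" for K
  proof -
    obtain r where r: "K \<subseteq> cball 0 r"
      using compact_imp_bounded[OF K] unfolding bounded_iff subset_eq mem_cball_0 by blast
    define Q where "Q = cball (0::'a) r"
    have [measurable]: "Q \<in> sets borel" "K \<in> sets borel" using K by (auto simp: Q_def borel_compact)
    have int_Q: "integrable lborel (\<lambda>x. indicator Q x *\<^sub>R (C * \<bar>u' x - \<phi> n x\<bar>))" for n
    proof -
      have "set_integrable lborel Q (\<lambda>x. u' x - \<phi> n x)"
        using gradient_limit_diff[OF lim, of n] by (simp add: gradient_limit_def Q_def)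
      then have "integrable lborel (\<lambda>x. C * norm (indicator Q x *\<^sub>R (u' x - \<phi> n x)))"
        unfolding set_integrable_def by (intro integrable_mult_right integrable_norm)
      then show ?thesis by (simp add: abs_mult mult_ac)
    qed
    have le: "(LINT x:K|lebesgue. \<bar>?v x - \<phi> n x * \<eta> x\<bar>) \<le> C * (LINT x:Q|lborel. \<bar>u' x - \<phi> n x\<bar>)" for n
    proof -
      have m1: "(\<lambda>x. indicat_real K x *\<^sub>R \<bar>\<eta> x * u' x - \<phi> n x * \<eta> x\<bar>) \<in> borel_measurable borel" by measurable
      have m2: "(\<lambda>x. indicat_real K x *\<^sub>R \<bar>?v x - \<phi> n x * \<eta> x\<bar>) \<in> borel_measurable lebesgue"
        using K loc_integrable_borel_measurable[OF loc(1)] borel_measurable_imp_lebesgue[OF test_function_measurable(1)[OF \<phi>]]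
          borel_measurable_imp_lebesgue[OF test_function_measurable(1)[OF \<eta>]]
        by (intro borel_measurable_scaleR borel_measurable_abs borel_measurable_diff borel_measurable_times
            borel_measurable_indicator) (auto simp: borel_compact)
      have "(LINT x:K|lebesgue. \<bar>?v x - \<phi> n x * \<eta> x\<bar>) = (\<integral>x. indicat_real K x *\<^sub>R \<bar>\<eta> x * u' x - \<phi> n x * \<eta> x\<bar> \<partial>lebesgue)"
        unfolding set_lebesgue_integral_def
        by (rule integral_cong_AE[OF m2 borel_measurable_imp_lebesgue[OF m1]])
           (use ueq in \<open>unfold AE_lebesgue_iff, eventually_elim, simp\<close>)
      also have "\<dots> = (\<integral>x. indicat_real K x *\<^sub>R \<bar>\<eta> x * u' x - \<phi> n x * \<eta> x\<bar> \<partial>lborel)"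
        by (rule integral_completion) (use m1 in simp)
      also have "\<dots> \<le> (\<integral>x. indicator Q x *\<^sub>R (C * \<bar>u' x - \<phi> n x\<bar>) \<partial>lborel)"
      proof (rule integral_mono')
        fix x
        have "\<bar>\<eta> x * u' x - \<phi> n x * \<eta> x\<bar> = \<bar>\<eta> x\<bar> * \<bar>u' x - \<phi> n x\<bar>"
          by (simp add: abs_mult[symmetric] algebra_simps)
        also have "\<dots> \<le> C * \<bar>u' x - \<phi> n x\<bar>" using C(1) by (intro mult_right_mono) auto
        finally show "indicat_real K x *\<^sub>R \<bar>\<eta> x * u' x - \<phi> n x * \<eta> x\<bar> \<le> indicator Q x *\<^sub>R (C * \<bar>u' x - \<phi> n x\<bar>)"
          using r C0 by (auto simp: indicator_def Q_def)
        show "0 \<le> indicator Q x *\<^sub>R (C * \<bar>u' x - \<phi> n x\<bar>)" using C0 by simp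
      qed (rule int_Q)
      also have "\<dots> = C * (LINT x:Q|lborel. \<bar>u' x - \<phi> n x\<bar>)"
        by (simp add: set_lebesgue_integral_def mult.left_commute)
      finally show ?thesis .
    qed
    have "(\<lambda>n. C * (LINT x:Q|lborel. \<bar>u' x - \<phi> n x\<bar>)) \<longlonglongrightarrow> C * 0"
      using lim by (intro tendsto_mult tendsto_const) (auto simp: gradient_limit_def Q_def)
    then have lim0: "(\<lambda>n. C * (LINT x:Q|lborel. \<bar>u' x - \<phi> n x\<bar>)) \<longlonglongrightarrow> 0" by simp
    have nonneg: "0 \<le> (LINT x:K|lebesgue. \<bar>?v x - \<phi> n x * \<eta> x\<bar>)" for n
      unfolding set_lebesgue_integral_def by (rule Bochner_Integration.integral_nonneg) simp
    show ?thesis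
      by (rule tendsto_sandwich[OF _ _ tendsto_const lim0]) (intro always_eventually allI le nonneg)+
  qed
  show "?v \<in> H1_dot"
    unfolding H1_dot_def
    using wv int_v conv L1 test_function_mult(1)[OF \<phi> \<eta>]
    by (intro CollectI conjI exI[of _ "\<lambda>n x. \<phi> n x * \<eta> x"]) blast+
qed

section \<open>Energy decay and compact support\<close>

text \<open>Along radii with increments \<open>2 \<delta>\<^sub>k\<close>, \<open>\<delta>\<^sub>k = \<delta>\<^sub>0 \<mu>\<^sup>k\<close>, the values of \<open>T\<close> decay like \<open>\<lambda>\<^sup>k\<close> with
  \<open>\<lambda> = 7/8\<close>. Choosing \<open>\<mu>\<^sup>m = \<lambda>\<^sup>s\<close> keeps \<open>\<delta>\<^sub>k\<^bsup>-m\<^esup> T\<^sub>k\<^sup>s\<close> bounded, and a large \<open>\<delta>\<^sub>0\<close>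
  makes \<open>K\<close> times this quantity at most \<open>1/8 = \<lambda> - 3/4\<close>. As the increments are summable, the
  radii stay bounded.\<close>

lemma decay_iteration:
  fixes T :: "real \<Rightarrow> real"
  assumes antimono: "\<And>\<rho> \<rho>'. \<rho>0 \<le> \<rho> \<Longrightarrow> \<rho> \<le> \<rho>' \<Longrightarrow> T \<rho>' \<le> T \<rho>" and nonneg: "\<And>\<rho>. T \<rho> \<ge> 0"
    and K: "K \<ge> 0" and m: "m > 0" and s: "s > 0"
    and step: "\<And>\<rho> \<delta>. \<rho>0 \<le> \<rho> \<Longrightarrow> \<delta> > 0 \<Longrightarrow>
      T (\<rho> + 2 * \<delta>) \<le> 3/4 * T \<rho> + K * \<delta> powr (-m) * (T \<rho>) powr (1 + s)"
  obtains R where "R \<ge> \<rho>0" "T R = 0"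
proof -
  define \<gamma> where "\<gamma> = 8 * K * (T \<rho>0) powr s + 1"
  have \<gamma>: "\<gamma> \<ge> 1" using K by (simp add: \<gamma>_def)
  define \<delta>0 where "\<delta>0 = \<gamma> powr (1 / m)"
  have \<delta>0: "\<delta>0 > 0" "\<delta>0 powr (-m) = 1 / \<gamma>"
    using \<gamma> m by (auto simp: \<delta>0_def powr_powr powr_minus divide_inverse)
  define l :: real where "l = 7/8"
  define \<mu> where "\<mu> = l powr (s / m)"
  have \<mu>: "0 < \<mu>" "\<mu> < 1" using m s powr_less_mono2[of "s / m" l 1] by (auto simp: \<mu>_def l_def)
  define \<rho> where "\<rho> = (\<lambda>k. \<rho>0 + 2 * \<delta>0 * (\<Sum>i<k. \<mu> ^ i))"
  have \<rho>_ge: "\<rho>0 \<le> \<rho> k" for k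
    using \<delta>0 \<mu> by (auto simp: \<rho>_def intro!: mult_nonneg_nonneg sum_nonneg)
  have \<rho>_le: "\<rho> k \<le> \<rho>0 + 2 * \<delta>0 * (1 / (1 - \<mu>))" for k
  proof -
    have "(\<Sum>i<k. \<mu> ^ i) \<le> (\<Sum>i. \<mu> ^ i)" using \<mu> by (intro sum_le_suminf summable_geometric) auto
    then have "(\<Sum>i<k. \<mu> ^ i) \<le> 1 / (1 - \<mu>)" using \<mu> suminf_geometric[of \<mu>] by simp
    then show ?thesis unfolding \<rho>_def using \<delta>0 by (intro add_left_mono mult_left_mono) auto
  qed
  have decay: "T (\<rho> k) \<le> T \<rho>0 * l ^ k" for k
  proof (induction k)
    case 0
    then show ?case by (simp add: \<rho>_def)
  next
    case (Suc k)
    define \<delta> where "\<delta> = \<delta>0 * \<mu> ^ k"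
    have \<delta>: "\<delta> > 0" using \<delta>0 \<mu> by (simp add: \<delta>_def)
    have l_pow: "l ^ k = l powr real k" by (simp add: powr_realpow l_def)
    have \<mu>_pow: "\<mu> ^ k = \<mu> powr real k" using \<mu> by (simp add: powr_realpow)
    have "\<delta> powr (-m) = \<delta>0 powr (-m) * (\<mu> ^ k) powr (-m)" unfolding \<delta>_def
      by (rule powr_mult)
    also have "(\<mu> ^ k) powr (-m) = l powr (s / m * real k * (-m))"
      by (simp only: \<mu>_pow) (simp only: \<mu>_def powr_powr)
    also have "s / m * real k * (-m) = - (s * real k)" using m by simp
    finally have \<delta>_powr: "\<delta> powr (-m) = l powr (- (s * real k)) / \<gamma>" using \<delta>0 by simp
    have "(T (\<rho> k)) powr s \<le> (T \<rho>0 * l ^ k) powr s"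
      using Suc.IH nonneg s by (intro powr_mono2) auto
    also have "\<dots> = (T \<rho>0) powr s * l powr (s * real k)"
      unfolding l_pow using nonneg[of \<rho>0] by (simp add: powr_mult powr_powr mult.commute)
    finally have "K * \<delta> powr (-m) * (T (\<rho> k)) powr s \<le>
        K * \<delta> powr (-m) * ((T \<rho>0) powr s * l powr (s * real k))"
      using K by (intro mult_left_mono) auto
    also have "\<dots> = K * (T \<rho>0) powr s * (l powr (- (s * real k)) * l powr (s * real k)) / \<gamma>"
      unfolding \<delta>_powr by simp
    also have "l powr (- (s * real k)) * l powr (s * real k) = 1"
      by (simp add: powr_add[symmetric] l_def)
    also have "K * (T \<rho>0) powr s * 1 / \<gamma> \<le> 1 / 8"
      using \<gamma> by (simp add: \<gamma>_def pos_divide_le_eq)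
    finally have coeff: "K * \<delta> powr (-m) * (T (\<rho> k)) powr s \<le> 1 / 8" .
    have "\<rho> (Suc k) = \<rho> k + 2 * \<delta>" by (simp add: \<rho>_def \<delta>_def algebra_simps)
    then have "T (\<rho> (Suc k)) \<le> 3/4 * T (\<rho> k) + K * \<delta> powr (-m) * (T (\<rho> k)) powr (1 + s)"
      using step[OF \<rho>_ge \<delta>] by simp
    also have "(T (\<rho> k)) powr (1 + s) = (T (\<rho> k)) powr s * T (\<rho> k)"
      using nonneg[of "\<rho> k"] by (simp add: powr_add powr_one mult.commute)
    also have "3/4 * T (\<rho> k) + K * \<delta> powr (-m) * ((T (\<rho> k)) powr s * T (\<rho> k)) =
        (3/4 + K * \<delta> powr (-m) * (T (\<rho> k)) powr s) * T (\<rho> k)"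
      by (simp add: algebra_simps)
    also have "\<dots> \<le> l * T (\<rho> k)" using coeff nonneg by (intro mult_right_mono) (auto simp: l_def)
    also have "\<dots> \<le> l * (T \<rho>0 * l ^ k)" using Suc.IH by (intro mult_left_mono) (auto simp: l_def)
    finally show ?case by (simp add: mult_ac)
  qed
  define R where "R = \<rho>0 + 2 * \<delta>0 * (1 / (1 - \<mu>))"
  have R: "R \<ge> \<rho>0" using \<delta>0 \<mu> by (simp add: R_def)
  have "T R \<le> T \<rho>0 * l ^ k" for k
    using antimono[OF \<rho>_ge \<rho>_le, of k] decay[of k] by (simp add: R_def)
  moreover have "(\<lambda>k. T \<rho>0 * l ^ k) \<longlonglongrightarrow> T \<rho>0 * 0"
    by (intro tendsto_mult tendsto_const LIMSEQ_power_zero) (simp add: l_def)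
  ultimately have "T R \<le> T \<rho>0 * 0" by (intro LIMSEQ_le_const) auto
  then show thesis using that[of R] R nonneg[of R] by simp
qed

text \<open>The union defining the complement of the support is reduced to a countable one by the
  Lindelof property.\<close>

lemma AE_not_in_ess_support:
  fixes f :: "'a::euclidean_space \<Rightarrow> real"
  shows "AE x in lebesgue. x \<notin> ess_support f \<longrightarrow> f x = 0"
proof -
  let ?\<U> = "{U. open U \<and> (AE x in lebesgue. x \<in> U \<longrightarrow> f x = 0)}"
  obtain \<V> where \<V>: "\<V> \<subseteq> ?\<U>" "countable \<V>" "\<Union>\<V> = \<Union>?\<U>"
    using Lindelof[of ?\<U>] by blast
  have "AE x in lebesgue. \<forall>U\<in>\<V>. x \<in> U \<longrightarrow> f x = 0"
    using \<V>(1,2) by (subst AE_ball_countable) auto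
  then show ?thesis
  proof eventually_elim
    case (elim x)
    show ?case unfolding ess_support_def \<V>(3)[symmetric] using elim by blast
  qed
qed

lemma compact_support_AE_0_outside:
  fixes f :: "'a::euclidean_space \<Rightarrow> real"
  assumes "has_compact_support f"
  obtains \<rho> where "\<rho> > 0" "AE x in lebesgue. norm x > \<rho> \<longrightarrow> f x = 0"
proof -
  have "bounded (ess_support f)"
    using assms compact_imp_bounded by (auto simp: has_compact_support_def)
  then obtain \<rho> where \<rho>: "\<rho> > 0" "\<forall>x\<in>ess_support f. norm x \<le> \<rho>" by (auto simp: bounded_pos)
  have "AE x in lebesgue. norm x > \<rho> \<longrightarrow> f x = 0"
    using AE_not_in_ess_support[of f] by eventually_elim (use \<rho>(2) in force)
  then show thesis using that \<rho>(1) by blast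
qed

lemma compact_supportI:
  fixes u :: "'a::euclidean_space \<Rightarrow> real"
  assumes "AE x in lebesgue. norm x > R \<longrightarrow> u x = 0"
  shows "has_compact_support u"
proof -
  have "ess_support u \<subseteq> cball 0 R"
  proof -
    have "open (- cball (0::'a) R)" "AE x in lebesgue. x \<in> - cball 0 R \<longrightarrow> u x = 0"
      using assms by (auto simp: not_le)
    then have "- cball 0 R \<subseteq> \<Union>{U. open U \<and> (AE x in lebesgue. x \<in> U \<longrightarrow> u x = 0)}" by blast
    then show ?thesis unfolding ess_support_def by blast
  qed
  moreover have "closed (ess_support u)"
    unfolding ess_support_def by (intro closed_Compl open_Union) auto
  ultimately show ?thesis unfolding has_compact_support_def
    using bounded_subset[OF bounded_cball] compact_eq_bounded_closed by blast
qed

text \<open>A convexity bound for \<open>x \<mapsto> x\<^sup>s\<close>. It turns the power of the integral in the energy into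
  a multiple of the integral itself, which can be localised.\<close>

lemma powr_difference_lower_bound:
  fixes A B s :: real
  assumes "0 \<le> B" "B \<le> A" "1 \<le> s"
  shows "A powr (s - 1) * (A - B) \<le> A powr s - B powr s"
proof -
  have eq: "x powr s = x powr (s - 1) * x" if "x \<ge> 0" for x
    using that powr_add[of x "s - 1" 1] by (simp add: powr_one)
  have "B powr s = B powr (s - 1) * B" using assms by (intro eq)
  also have "\<dots> \<le> A powr (s - 1) * B" using assms by (intro mult_right_mono powr_mono2) auto
  finally show ?thesis using eq[of A] assms by (simp add: algebra_simps)
qed


lemma integral_lebesgue_lborel_cong:
  fixes h h' :: "'a::euclidean_space \<Rightarrow> real"
  assumes h: "h \<in> borel_measurable lebesgue" and h': "h' \<in> borel_measurable borel"
    and eq: "AE x in lborel. h x = h' x"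
  shows "integrable lebesgue h \<longleftrightarrow> integrable lborel h'"
    and "(\<integral>x. h x \<partial>lebesgue) = (\<integral>x. h' x \<partial>lborel)"
proof -
  note h'_leb = borel_measurable_imp_lebesgue[OF h']
  have h'_lborel: "h' \<in> borel_measurable lborel" using h' by simp
  have eq': "AE x in lebesgue. h x = h' x" using eq by (simp only: AE_lebesgue_iff)
  have "integrable lebesgue h \<longleftrightarrow> integrable lebesgue h'"
    by (rule integrable_cong_AE[OF h h'_leb eq'])
  then show "integrable lebesgue h \<longleftrightarrow> integrable lborel h'"
    by (simp only: integrable_completion[OF h'_lborel])
  have "(\<integral>x. h x \<partial>lebesgue) = (\<integral>x. h' x \<partial>lebesgue)"
    by (rule integral_cong_AE[OF h h'_leb eq'])
  then show "(\<integral>x. h x \<partial>lebesgue) = (\<integral>x. h' x \<partial>lborel)"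
    by (simp only: integral_completion[OF h'_lborel])
qed

text \<open>A cut-off function equal to one where \<open>f\<close> lives does not change the integral of \<open>u f\<close>, so
  that this integral cancels when the energies of \<open>u\<close> and \<open>\<eta> u\<close> are compared.\<close>

lemma minimizer_cutoff_inequality:
  fixes u f :: "'a::euclidean_space \<Rightarrow> real" and p :: real
  defines "r \<equiv> 2 * p / (p + 1)"
  assumes p: "p > 0" and min: "is_arg_min (energy p f) (admissible p) u"
    and \<eta>: "\<eta> \<in> test_functions" "\<And>x. 0 \<le> \<eta> x" "\<And>x. \<eta> x \<le> 1"
    and f: "f \<in> borel_measurable lebesgue" "AE x in lebesgue. f x = 0 \<or> \<eta> x = 1"
    and lim: "gradient_limit \<phi> u' g'"
    and ueq: "AE x in lborel. u x = u' x" and geq: "AE x in lborel. weak_grad u x = g' x"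
  shows "integrable lborel (\<lambda>x. \<bar>u' x\<bar> powr r)"
    and "integrable lborel (\<lambda>x. \<bar>\<eta> x * u' x\<bar> powr r)"
    and "integrable lborel (\<lambda>x. (norm (\<eta> x *\<^sub>R g' x + u' x *\<^sub>R grad \<eta> x))\<^sup>2)"
    and "(\<integral>x. (norm (g' x))\<^sup>2 \<partial>lborel) + (\<integral>x. \<bar>u' x\<bar> powr r \<partial>lborel) powr ((p + 1) / p) \<le>
      (\<integral>x. (norm (\<eta> x *\<^sub>R g' x + u' x *\<^sub>R grad \<eta> x))\<^sup>2 \<partial>lborel) +
      (\<integral>x. \<bar>\<eta> x * u' x\<bar> powr r \<partial>lborel) powr ((p + 1) / p)"
proof -
  let ?v = "\<lambda>x. \<eta> x * u x"
  have r: "r > 0" using p by (simp add: r_def)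
  have adm: "u \<in> H1_dot" "integrable lebesgue (\<lambda>x. \<bar>u x\<bar> powr r)"
    using min by (auto simp: is_arg_min_def admissible_def r_def)
  note v = H1_dot_product[OF adm(1) \<eta>(1)]
  have meas: "u \<in> borel_measurable lebesgue" "weak_grad u \<in> borel_measurable lebesgue"
    "?v \<in> borel_measurable lebesgue" "weak_grad ?v \<in> borel_measurable lebesgue"
    using H1_dot_has_weak_gradient[OF adm(1)] H1_dot_has_weak_gradient[OF v(1)]
    unfolding has_weak_gradient_def by (blast intro: loc_integrable_borel_measurable)+
  have bu[measurable]: "u' \<in> borel_measurable borel" and bg[measurable]: "g' \<in> borel_measurable borel"
    using lim by (auto simp: gradient_limit_def)
  note [measurable] = test_function_measurable[OF \<eta>(1)]
  have veq: "AE x in lborel. weak_grad ?v x = \<eta> x *\<^sub>R g' x + u' x *\<^sub>R grad \<eta> x"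
    using v(2)[unfolded AE_lebesgue_iff] ueq geq by eventually_elim simp
  have 1: "(\<integral>x. (norm (weak_grad u x))\<^sup>2 \<partial>lebesgue) = (\<integral>x. (norm (g' x))\<^sup>2 \<partial>lborel)"
  proof (rule integral_lebesgue_lborel_cong(2))
    show "(\<lambda>x. (norm (weak_grad u x))\<^sup>2) \<in> borel_measurable lebesgue" using meas(2) by simp
    show "AE x in lborel. (norm (weak_grad u x))\<^sup>2 = (norm (g' x))\<^sup>2"
      using geq by eventually_elim simp
  qed simp
  have m2: "(\<lambda>x. (norm (weak_grad ?v x))\<^sup>2) \<in> borel_measurable lebesgue" using meas(4) by simp
  have e2: "AE x in lborel. (norm (weak_grad ?v x))\<^sup>2 = (norm (\<eta> x *\<^sub>R g' x + u' x *\<^sub>R grad \<eta> x))\<^sup>2"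
    using veq by eventually_elim simp
  have b2: "(\<lambda>x. (norm (\<eta> x *\<^sub>R g' x + u' x *\<^sub>R grad \<eta> x))\<^sup>2) \<in> borel_measurable borel" by simp
  note 2 = integral_lebesgue_lborel_cong[OF m2 b2 e2]
  have m3: "(\<lambda>x. \<bar>u x\<bar> powr r) \<in> borel_measurable lebesgue" using meas(1) by simp
  have e3: "AE x in lborel. \<bar>u x\<bar> powr r = \<bar>u' x\<bar> powr r" using ueq by eventually_elim simp
  have b3: "(\<lambda>x. \<bar>u' x\<bar> powr r) \<in> borel_measurable borel" by simp
  note 3 = integral_lebesgue_lborel_cong[OF m3 b3 e3]
  have m4: "(\<lambda>x. \<bar>?v x\<bar> powr r) \<in> borel_measurable lebesgue" using meas(3) by simp
  have e4: "AE x in lborel. \<bar>?v x\<bar> powr r = \<bar>\<eta> x * u' x\<bar> powr r" using ueq by eventually_elim simp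
  have b4: "(\<lambda>x. \<bar>\<eta> x * u' x\<bar> powr r) \<in> borel_measurable borel" by simp
  note 4 = integral_lebesgue_lborel_cong[OF m4 b4 e4]
  show int3: "integrable lborel (\<lambda>x. \<bar>u' x\<bar> powr r)" using 3(1) adm(2) by simp
  show int4: "integrable lborel (\<lambda>x. \<bar>\<eta> x * u' x\<bar> powr r)"
  proof (rule Bochner_Integration.integrable_bound[OF int3])
    show "AE x in lborel. norm (\<bar>\<eta> x * u' x\<bar> powr r) \<le> norm (\<bar>u' x\<bar> powr r)"
      using \<eta>(2,3) r by (auto simp: abs_mult mult_left_le_one_le intro!: powr_mono2)
  qed (use b4 in simp)
  show "integrable lborel (\<lambda>x. (norm (\<eta> x *\<^sub>R g' x + u' x *\<^sub>R grad \<eta> x))\<^sup>2)"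
    using 2(1) v(1) by (simp add: H1_dot_def)
  have "admissible p ?v" using v(1) 4(1) int4 by (simp add: admissible_def r_def)
  then have "energy p f u \<le> energy p f ?v"
    using min by (auto simp: is_arg_min_def not_less)
  moreover have "(\<integral>x. u x * f x \<partial>lebesgue) = (\<integral>x. ?v x * f x \<partial>lebesgue)"
  proof (rule integral_cong_AE)
    show "(\<lambda>x. u x * f x) \<in> borel_measurable lebesgue" "(\<lambda>x. ?v x * f x) \<in> borel_measurable lebesgue"
      using meas(1,3) f(1) by (auto intro: borel_measurable_times)
    show "AE x in lebesgue. u x * f x = ?v x * f x" using f(2) by eventually_elim auto
  qed
  ultimately show "(\<integral>x. (norm (g' x))\<^sup>2 \<partial>lborel) + (\<integral>x. \<bar>u' x\<bar> powr r \<partial>lborel) powr ((p + 1) / p) \<le>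
      (\<integral>x. (norm (\<eta> x *\<^sub>R g' x + u' x *\<^sub>R grad \<eta> x))\<^sup>2 \<partial>lborel) +
      (\<integral>x. \<bar>\<eta> x * u' x\<bar> powr r \<partial>lborel) powr ((p + 1) / p)"
    unfolding energy_def r_def[symmetric] 1 2(2) 3(2) 4(2) by linarith
qed

text \<open>The pointwise balance between \<open>u\<close> and \<open>\<eta> u\<close>: inside radius \<open>\<rho>\<close> nothing changes, beyond
  \<open>\<rho> + \<delta>\<close> the whole density \<open>e\<close> is saved, and in between at most \<open>e + 2 (L/\<delta>)\<^sup>2 u\<^sup>2\<close> is spent. In
  terms of the densities on the exteriors of the two balls, the shell is the difference of these.\<close>

lemma cutoff_energy_split:
  fixes u :: "'a::euclidean_space \<Rightarrow> real" and g :: "'a \<Rightarrow> 'a" and x :: 'a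
  assumes c: "c \<ge> 0" and r: "r > 0" and \<delta>: "\<delta> > 0" and cutoff: "radial_cutoff L \<rho> \<delta> \<eta>"
  defines "e \<equiv> (norm (g x))\<^sup>2 + c * \<bar>u x\<bar> powr r"
  shows "2 * (indicator {x. \<rho> + \<delta> \<le> norm x} x * e) - indicator {x. \<rho> \<le> norm x} x * e
      - 2 * (L / \<delta>)\<^sup>2 * (indicator {x. \<rho> \<le> norm x \<and> norm x < \<rho> + \<delta>} x * (u x)\<^sup>2) \<le>
    (norm (g x))\<^sup>2 - (norm (\<eta> x *\<^sub>R g x + u x *\<^sub>R grad \<eta> x))\<^sup>2
      + c * (\<bar>u x\<bar> powr r - \<bar>\<eta> x * u x\<bar> powr r)"
proof -
  note \<eta> = radial_cutoffD(1)[OF cutoff] radial_cutoffD(2-8)[OF cutoff, of x]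
  define l where "l = L / \<delta>"
  consider "norm x < \<rho>" | "\<rho> \<le> norm x" "norm x < \<rho> + \<delta>" | "\<rho> + \<delta> \<le> norm x" by linarith
  then show ?thesis
  proof cases
    case 1
    then show ?thesis using \<eta> \<delta> by simp
  next
    case 2
    let ?N = "(norm (\<eta> x *\<^sub>R g x + u x *\<^sub>R grad \<eta> x))\<^sup>2"
    have "norm (\<eta> x *\<^sub>R g x + u x *\<^sub>R grad \<eta> x) \<le> norm (g x) + l * \<bar>u x\<bar>"
    proof (rule norm_triangle_le, rule add_mono)
      show "norm (\<eta> x *\<^sub>R g x) \<le> norm (g x)" using \<eta>(2,3) by (simp add: mult_left_le_one_le)
      show "norm (u x *\<^sub>R grad \<eta> x) \<le> l * \<bar>u x\<bar>"
        using mult_left_mono[OF \<eta>(6), of "\<bar>u x\<bar>"] by (simp add: l_def mult.commute)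
    qed
    then have "?N \<le> (norm (g x) + l * \<bar>u x\<bar>)\<^sup>2" by (intro power_mono) auto
    also have "\<dots> \<le> 2 * (norm (g x))\<^sup>2 + 2 * l\<^sup>2 * (u x)\<^sup>2"
      using zero_le_power2[of "norm (g x) - l * \<bar>u x\<bar>"]
      by (simp add: power2_sum power2_diff power_mult_distrib)
    finally have N: "?N \<le> 2 * (norm (g x))\<^sup>2 + 2 * l\<^sup>2 * (u x)\<^sup>2" .
    have "\<bar>\<eta> x * u x\<bar> powr r \<le> \<bar>u x\<bar> powr r"
      using \<eta>(2,3) r by (intro powr_mono2) (auto simp: abs_mult mult_left_le_one_le)
    then have "c * (\<bar>u x\<bar> powr r - \<bar>\<eta> x * u x\<bar> powr r) \<ge> 0" using c by simp
    moreover have "c * \<bar>u x\<bar> powr r \<ge> 0" using c by simp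
    ultimately show ?thesis using N 2 by (simp add: e_def l_def)
  next
    case 3
    then show ?thesis using \<eta> \<delta> by (simp add: e_def)
  qed
qed

lemma integrable_shell_square:
  fixes u :: "'a::euclidean_space \<Rightarrow> real"
  assumes lim: "gradient_limit \<phi> u g"
  shows "integrable lborel (\<lambda>x. indicator {x. \<rho> \<le> norm x \<and> norm x < R} x * (u x)\<^sup>2)"
proof (rule integrableI_bounded)
  have [measurable]: "u \<in> borel_measurable borel" using lim by (simp add: gradient_limit_def)
  show "(\<lambda>x. indicator {x. \<rho> \<le> norm x \<and> norm x < R} x * (u x)\<^sup>2) \<in> borel_measurable lborel"
    by measurable
  have "(\<integral>\<^sup>+x. ennreal (norm (indicat_real {x. \<rho> \<le> norm x \<and> norm x < R} x * (u x)\<^sup>2)) \<partial>lborel) \<le>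
      (\<integral>\<^sup>+x\<in>cball 0 R. ennreal ((u x)\<^sup>2) \<partial>lborel)"
    by (intro nn_integral_mono) (auto simp: indicator_def)
  also have "\<dots> < \<infinity>" by (rule nn_square_integral_cball_finite[OF lim])
  finally show "(\<integral>\<^sup>+x. ennreal (norm (indicat_real {x. \<rho> \<le> norm x \<and> norm x < R} x * (u x)\<^sup>2)) \<partial>lborel) < \<infinity>" .
qed

text \<open>Interpolation on a shell, with both ingredients controlled by one bound \<open>t\<close> for the energy
  outside the slightly smaller radius \<open>\<rho>\<close>.\<close>

lemma shell_square_integral_le:
  fixes u :: "'a::euclidean_space \<Rightarrow> real"
  assumes lim: "gradient_limit \<phi> u g" and h: "h > 0" "\<rho> + h \<le> \<rho>1"
    and r: "0 < r" "r \<le> 2" and c: "c > 0" and t: "t \<ge> 0"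
    and g: "(\<integral>\<^sup>+x\<in>{x. \<rho> \<le> norm x}. ennreal ((norm (g x))\<^sup>2) \<partial>lborel) \<le> ennreal t"
    and u: "(\<integral>\<^sup>+x\<in>{x. \<rho> \<le> norm x}. ennreal (\<bar>u x\<bar> powr r) \<partial>lborel) \<le> ennreal (t / c)"
  shows "(\<integral>x. indicator {x. \<rho>1 \<le> norm x \<and> norm x < R} x * (u x)\<^sup>2 \<partial>lborel) \<le>
    16 * h\<^sup>2 * t +
    (2 powr (r + 1) * (t / c) / measure lborel (ball (0::'a) h)) powr ((2 - r) / r) * (t / c)"
proof -
  let ?S = "{x::'a. \<rho>1 \<le> norm x \<and> norm x < R}" and ?S' = "{x::'a. \<rho> \<le> norm x}"
  let ?k = "(2 powr (r + 1) * (t / c) / measure lborel (ball (0::'a) h)) powr ((2 - r) / r)"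
  have [measurable]: "u \<in> borel_measurable borel" using lim by (simp add: gradient_limit_def)
  have S': "?S' \<in> sets borel" and S: "?S \<in> sets borel" by measurable
  have bounded: "bounded ?S" by (rule bounded_subset[OF bounded_ball[of 0 R]]) auto
  have sub: "x + z \<in> ?S'" if "x \<in> ?S" "norm z < h" for x z
    using that h(2) norm_diff_ineq[of x z] by auto
  have small: "(\<integral>\<^sup>+x\<in>?S. ennreal (\<bar>u x\<bar> powr r) \<partial>lborel) \<le> ennreal (t / c)"
    by (rule order_trans[OF _ u], rule nn_integral_mono) (use h in \<open>auto simp: indicator_def\<close>)
  have "ennreal (\<integral>x. indicator ?S x * (u x)\<^sup>2 \<partial>lborel) = (\<integral>\<^sup>+x. ennreal (indicator ?S x * (u x)\<^sup>2) \<partial>lborel)"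
    using integrable_shell_square[OF lim, of \<rho>1 R] by (intro nn_integral_eq_integral[symmetric]) auto
  also have "\<dots> = (\<integral>\<^sup>+x\<in>?S. ennreal ((u x)\<^sup>2) \<partial>lborel)"
    by (intro nn_integral_cong) (auto simp: indicator_def)
  also have "\<dots> \<le> 16 * ennreal (h\<^sup>2) * (\<integral>\<^sup>+x\<in>?S'. ennreal ((norm (g x))\<^sup>2) \<partial>lborel) +
      ennreal ?k * (\<integral>\<^sup>+x\<in>?S. ennreal (\<bar>u x\<bar> powr r) \<partial>lborel)"
    using t c by (intro gradient_limit_interpolation[OF lim S S' bounded h(1) r _ sub u]) auto
  also have "\<dots> \<le> 16 * ennreal (h\<^sup>2) * ennreal t + ennreal ?k * ennreal (t / c)"
    by (intro add_mono mult_left_mono g small) simp_all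
  also have "\<dots> = ennreal (16 * h\<^sup>2 * t + ?k * (t / c))"
  proof -
    have "16 * ennreal (h\<^sup>2) * ennreal t = ennreal (16 * h\<^sup>2 * t)" by (simp add: ennreal_mult')
    moreover have "ennreal ?k * ennreal (t / c) = ennreal (?k * (t / c))"
      by (rule ennreal_mult'[symmetric]) simp
    ultimately show ?thesis using t c by (simp only:) (intro ennreal_plus[symmetric], auto)
  qed
  finally show ?thesis using t c by (subst (asm) ennreal_le_iff) auto
qed

theorem proposition5p5:
  fixes f :: "'a::euclidean_space \<Rightarrow> real" and p :: real and q :: ereal
  assumes "p > 0"
    and "q > ereal (real DIM('a) / 2)" and "q \<ge> 1"
    and "f \<in> Lq q"
    and "AE x in lebesgue. f x \<ge> 0"
    and "has_compact_support f"
  shows "\<forall>u. is_arg_min (energy p f) (admissible p) u \<longrightarrow> has_compact_support u"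
proof (intro allI impI)
  fix u assume min: "is_arg_min (energy p f) (admissible p) u"
  have p: "p > 0" by (rule assms)
  have f: "f \<in> borel_measurable lebesgue" using assms(4) by (simp add: Lq_def)
  obtain \<rho>f where \<rho>f: "\<rho>f > 0" and f_0: "AE x in lebesgue. norm x > \<rho>f \<longrightarrow> f x = 0"
    by (rule compact_support_AE_0_outside[OF assms(6)])
  have "u \<in> H1_dot" using min by (simp add: is_arg_min_def admissible_def)
  then obtain \<phi> u' g' where lim: "gradient_limit \<phi> u' g'" and ueq: "AE x in lborel. u x = u' x"
    and geq: "AE x in lborel. weak_grad u x = g' x" and g'_L2: "integrable lborel (\<lambda>x. (norm (g' x))\<^sup>2)"
    by (rule H1_dot_gradient_limit)
  have [measurable]: "u' \<in> borel_measurable borel" "g' \<in> borel_measurable borel"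
    using lim by (auto simp: gradient_limit_def)
  \<comment> \<open>The exponent \<open>s\<close> equals \<open>1 / p\<close>: it is both the gain in the interpolation inequality and the
    surplus over one of the outer exponent \<open>(p + 1) / p\<close> in the energy.\<close>
  define r where "r = 2 * p / (p + 1)"
  define s where "s = (2 - r) / r"
  have r: "0 < r" "r \<le> 2" using p by (auto simp: r_def divide_simps)
  have "2 - r = 2 / (p + 1)" using p by (simp add: r_def field_simps)
  also have "\<dots> = r / p" using p by (simp add: r_def)
  finally have "2 - r = r / p" .
  then have "s = 1 / p" using r(1) by (simp add: s_def)
  then have s: "s = (p + 1) / p - 1" "s > 0" using p by (simp_all add: add_divide_distrib)
  obtain L where L: "L > 0"
    and cutoff: "\<And>\<rho> \<delta>. \<rho> \<ge> 0 \<Longrightarrow> \<delta> > 0 \<Longrightarrow> \<exists>\<eta>::'a \<Rightarrow> real. radial_cutoff L \<rho> \<delta> \<eta>"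
    by (rule smooth_cutoff) blast
  have f_cut: "AE x in lebesgue. f x = 0 \<or> \<eta> x = 1"
    if "\<rho> \<ge> \<rho>f" "\<And>x. norm x \<le> \<rho> \<Longrightarrow> \<eta> x = 1" for \<rho> and \<eta> :: "'a \<Rightarrow> real"
    using f_0 by eventually_elim (use that in force)
  have int_u: "integrable lborel (\<lambda>x. \<bar>u' x\<bar> powr r)"
  proof -
    obtain \<eta> :: "'a \<Rightarrow> real" where "radial_cutoff L \<rho>f 1 \<eta>" using cutoff[of \<rho>f 1] \<rho>f by auto
    note \<eta> = radial_cutoffD[OF this]
    show ?thesis unfolding r_def
      by (rule minimizer_cutoff_inequality(1)[OF p min \<eta>(1-3) f f_cut[OF order_refl \<eta>(4)] lim ueq geq])
  qed
  define A where "A = (\<integral>x. \<bar>u' x\<bar> powr r \<partial>lborel)"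
  have A0: "A \<ge> 0" by (simp add: A_def)
  show "has_compact_support u"
  proof (cases "A = 0")
    case True
    then have "AE x in lborel. \<bar>u' x\<bar> powr r = 0"
      unfolding A_def using int_u by (subst (asm) integral_nonneg_eq_0_iff_AE) auto
    then have "AE x in lborel. u x = 0" using ueq by eventually_elim simp
    then show ?thesis by (intro compact_supportI[of 0]) (auto simp: AE_lebesgue_iff)
  next
    case False
    \<comment> \<open>The weight \<open>c\<close> is the one produced by the convexity bound at \<open>A\<close>.\<close>
    define c where "c = A powr s"
    have c: "c > 0" using False A0 by (simp add: c_def)
    define e where "e = (\<lambda>x. (norm (g' x))\<^sup>2 + c * \<bar>u' x\<bar> powr r)"
    have e_nonneg: "e x \<ge> 0" for x using c by (simp add: e_def)
    define E where "E = (\<lambda>\<rho>. {x::'a. \<rho> \<le> norm x})"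
    have [measurable]: "E \<rho> \<in> sets borel" for \<rho> unfolding E_def by measurable
    have [measurable]: "e \<in> borel_measurable borel" unfolding e_def by measurable
    have int_e: "integrable lborel e" unfolding e_def using g'_L2 int_u by simp
    have int_Ee: "integrable lborel (\<lambda>x. indicator (E \<rho>) x * e x)" for \<rho>
      using integrable_mult_indicator[OF _ int_e, of "E \<rho>"] by simp
    define T where "T = (\<lambda>\<rho>. \<integral>x. indicator (E \<rho>) x * e x \<partial>lborel)"
    have T_nonneg: "T \<rho> \<ge> 0" for \<rho> unfolding T_def using e_nonneg by (intro Bochner_Integration.integral_nonneg) simp
    have T_antimono: "T \<rho>' \<le> T \<rho>" if "\<rho> \<le> \<rho>'" for \<rho> \<rho>'
      unfolding T_def using that e_nonneg
      by (intro integral_mono int_Ee) (auto simp: indicator_def E_def)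
    have T_nn: "(\<integral>\<^sup>+x. ennreal (indicator (E \<rho>) x * e x) \<partial>lborel) = ennreal (T \<rho>)" for \<rho>
      unfolding T_def using e_nonneg by (intro nn_integral_eq_integral int_Ee) simp
    have T_g: "(\<integral>\<^sup>+x\<in>{x. \<rho> \<le> norm x}. ennreal ((norm (g' x))\<^sup>2) \<partial>lborel) \<le> ennreal (T \<rho>)" for \<rho>
      unfolding T_nn[symmetric]
      using c by (intro nn_integral_mono) (auto simp: indicator_def E_def e_def intro!: ennreal_leI)
    have T_u: "(\<integral>\<^sup>+x\<in>{x. \<rho> \<le> norm x}. ennreal (\<bar>u' x\<bar> powr r) \<partial>lborel) \<le> ennreal (T \<rho> / c)" for \<rho>
    proof -
      have "(\<integral>\<^sup>+x\<in>{x. \<rho> \<le> norm x}. ennreal (\<bar>u' x\<bar> powr r) \<partial>lborel) \<le>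
          (\<integral>\<^sup>+x. ennreal (1 / c) * ennreal (indicator (E \<rho>) x * e x) \<partial>lborel)"
      proof (rule nn_integral_mono)
        fix x
        have "\<bar>u' x\<bar> powr r \<le> 1 / c * e x" using c by (simp add: e_def field_simps)
        then show "ennreal (\<bar>u' x\<bar> powr r) * indicator {x. \<rho> \<le> norm x} x \<le>
            ennreal (1 / c) * ennreal (indicator (E \<rho>) x * e x)"
          using c by (auto simp: indicator_def E_def ennreal_mult'[symmetric] intro: ennreal_leI)
      qed
      also have "\<dots> = ennreal (1 / c) * ennreal (T \<rho>)" by (subst nn_integral_cmult) (simp_all add: T_nn)
      also have "\<dots> = ennreal (T \<rho> / c)" using c by (simp add: ennreal_mult'[symmetric])
      finally show ?thesis .
    qed
    \<comment> \<open>Minimality against \<open>\<eta> u\<close> gives a Caccioppoli inequality in which the energy between the two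
      radii appears only as the difference of the exterior energies.\<close>
    have caccioppoli: "2 * T (\<rho> + \<delta>) \<le> T \<rho> +
        2 * (L / \<delta>)\<^sup>2 * (\<integral>x. indicator {x. \<rho> \<le> norm x \<and> norm x < \<rho> + \<delta>} x * (u' x)\<^sup>2 \<partial>lborel)"
      if \<rho>: "\<rho> \<ge> \<rho>f" and \<delta>: "\<delta> > 0" for \<rho> \<delta>
    proof -
      let ?W = "\<lambda>x. indicator {x. \<rho> \<le> norm x \<and> norm x < \<rho> + \<delta>} x * (u' x)\<^sup>2"
      obtain \<eta> :: "'a \<Rightarrow> real" where cutoff_\<eta>: "radial_cutoff L \<rho> \<delta> \<eta>"
        using cutoff[of \<rho> \<delta>] \<rho> \<rho>f \<delta> by auto
      note \<eta> = radial_cutoffD[OF cutoff_\<eta>]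
      let ?N = "\<lambda>x. (norm (\<eta> x *\<^sub>R g' x + u' x *\<^sub>R grad \<eta> x))\<^sup>2"
      let ?B = "\<integral>x. \<bar>\<eta> x * u' x\<bar> powr r \<partial>lborel"
      note cut = minimizer_cutoff_inequality[OF p min \<eta>(1-3) f f_cut[OF \<rho> \<eta>(4)] lim ueq geq,
          folded r_def A_def]
      have B: "0 \<le> ?B" "?B \<le> A"
      proof -
        show "?B \<le> A" unfolding A_def
          using \<eta>(2,3) r(1)
          by (intro integral_mono cut(1,2)) (auto simp: abs_mult mult_left_le_one_le intro!: powr_mono2)
      qed simp
      have "A powr s * (A - ?B) \<le> A powr ((p + 1) / p) - ?B powr ((p + 1) / p)"
        unfolding s(1) using p by (intro powr_difference_lower_bound B) (simp add: field_simps)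
      then have "c * (A - ?B) \<le> A powr ((p + 1) / p) - ?B powr ((p + 1) / p)" by (simp add: c_def)
      then have le_0: "(\<integral>x. (norm (g' x))\<^sup>2 \<partial>lborel) - (\<integral>x. ?N x \<partial>lborel) + c * (A - ?B) \<le> 0"
        using cut(4) by linarith
      have int_W: "integrable lborel ?W" by (rule integrable_shell_square[OF lim])
      have "2 * T (\<rho> + \<delta>) - T \<rho> - 2 * (L / \<delta>)\<^sup>2 * (\<integral>x. ?W x \<partial>lborel) =
          (\<integral>x. 2 * (indicator (E (\<rho> + \<delta>)) x * e x) - indicator (E \<rho>) x * e x - 2 * (L / \<delta>)\<^sup>2 * ?W x \<partial>lborel)"
        using int_Ee int_W by (simp add: T_def)
      also have "\<dots> \<le> (\<integral>x. (norm (g' x))\<^sup>2 - ?N x + c * (\<bar>u' x\<bar> powr r - \<bar>\<eta> x * u' x\<bar> powr r) \<partial>lborel)"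
      proof (rule integral_mono)
        show "integrable lborel (\<lambda>x. 2 * (indicator (E (\<rho> + \<delta>)) x * e x) - indicator (E \<rho>) x * e x - 2 * (L / \<delta>)\<^sup>2 * ?W x)"
          using int_Ee int_W by (intro Bochner_Integration.integrable_diff integrable_mult_right) auto
        show "integrable lborel (\<lambda>x. (norm (g' x))\<^sup>2 - ?N x + c * (\<bar>u' x\<bar> powr r - \<bar>\<eta> x * u' x\<bar> powr r))"
          using g'_L2 cut(1-3)
          by (intro Bochner_Integration.integrable_add Bochner_Integration.integrable_diff integrable_mult_right) auto
        fix x
        show "2 * (indicator (E (\<rho> + \<delta>)) x * e x) - indicator (E \<rho>) x * e x - 2 * (L / \<delta>)\<^sup>2 * ?W x \<le>
            (norm (g' x))\<^sup>2 - ?N x + c * (\<bar>u' x\<bar> powr r - \<bar>\<eta> x * u' x\<bar> powr r)"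
          unfolding e_def E_def
          by (rule cutoff_energy_split[OF _ r(1) \<delta> cutoff_\<eta>]) (use c in simp)
      qed
      also have "\<dots> = (\<integral>x. (norm (g' x))\<^sup>2 \<partial>lborel) - (\<integral>x. ?N x \<partial>lborel) + c * (A - ?B)"
        unfolding A_def using g'_L2 cut(1-3) by simp
      finally show ?thesis using le_0 by linarith
    qed
    define \<omega> where "\<omega> = unit_ball_vol (real DIM('a))"
    have \<omega>: "\<omega> > 0" by (simp add: \<omega>_def)
    \<comment> \<open>Interpolating at scale \<open>\<tau> \<delta>\<close> with small \<open>\<tau>\<close> makes the gradient term at most a quarter of
      the energy, independently of \<open>\<delta>\<close>.\<close>
    define \<tau> where "\<tau> = min 1 (1 / (8 * L))"
    have \<tau>: "0 < \<tau>" "\<tau> \<le> 1" using L by (auto simp: \<tau>_def)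
    have "L * \<tau> \<le> L * (1 / (8 * L))" using L unfolding \<tau>_def by (intro mult_left_mono) auto
    then have "L * \<tau> \<le> 1 / 8" using L by simp
    then have "(L * \<tau>)\<^sup>2 \<le> (1 / 8)\<^sup>2" using L \<tau> by (intro power_mono) auto
    then have "L\<^sup>2 * \<tau>\<^sup>2 \<le> (1 / 8)\<^sup>2" by (simp only: power_mult_distrib)
    then have L\<tau>: "L\<^sup>2 * \<tau>\<^sup>2 \<le> 1 / 64" by (simp add: power_divide)
    define a where "a = 2 powr (r + 1) / (c * \<omega> * \<tau> ^ DIM('a))"
    have a: "a > 0" using c \<omega> \<tau> by (simp add: a_def)
    define m where "m = 2 + real DIM('a) * s"
    define K where "K = L\<^sup>2 * a powr s / c"
    have decay: "T (\<rho> + 2 * \<delta>) \<le> 3/4 * T \<rho> + K * \<delta> powr (-m) * (T \<rho>) powr (1 + s)"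
      if \<rho>: "\<rho>f \<le> \<rho>" and \<delta>: "\<delta> > 0" for \<rho> \<delta>
    proof -
      \<comment> \<open>The first \<open>\<delta>\<close> leaves room for the translations, the second one is used for the cut-off.\<close>
      let ?U = "\<integral>x. indicator {x. \<rho> + \<delta> \<le> norm x \<and> norm x < \<rho> + \<delta> + \<delta>} x * (u' x)\<^sup>2 \<partial>lborel"
      let ?Q = "(2 powr (r + 1) * (T \<rho> / c) / measure lborel (ball (0::'a) (\<tau> * \<delta>))) powr s * (T \<rho> / c)"
      have "\<tau> * \<delta> \<le> \<delta>" using \<tau> \<delta> by simp
      then have U: "?U \<le> 16 * (\<tau> * \<delta>)\<^sup>2 * T \<rho> + ?Q"
        unfolding s_def using \<tau> \<delta> c T_nonneg
        by (intro shell_square_integral_le[OF lim _ _ r c _ T_g T_u]) auto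
      have "measure lborel (ball (0::'a) (\<tau> * \<delta>)) = \<omega> * \<tau> ^ DIM('a) * \<delta> ^ DIM('a)"
        using \<tau> \<delta> by (simp add: content_ball \<omega>_def power_mult_distrib)
      then have "2 powr (r + 1) * (T \<rho> / c) / measure lborel (ball (0::'a) (\<tau> * \<delta>)) =
          a * T \<rho> * inverse (\<delta> ^ DIM('a))"
        by (simp add: a_def divide_inverse mult_ac)
      also have "inverse (\<delta> ^ DIM('a)) = \<delta> powr (- real DIM('a))"
        using \<delta> by (simp add: powr_minus powr_realpow)
      finally have "?Q = (a * T \<rho> * \<delta> powr (- real DIM('a))) powr s * (T \<rho> / c)"
        by (rule arg_cong[where f = "\<lambda>y. y powr s * (T \<rho> / c)"])
      also have "\<dots> = a powr s * (T \<rho>) powr s * \<delta> powr (- real DIM('a) * s) * (T \<rho> / c)"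
        by (simp only: powr_mult powr_powr)
      also have "\<dots> = a powr s * ((T \<rho>) powr s * T \<rho>) * \<delta> powr (- real DIM('a) * s) / c"
        by (simp add: divide_inverse mult_ac)
      finally have Q: "?Q = a powr s * ((T \<rho>) powr s * T \<rho>) * \<delta> powr (- real DIM('a) * s) / c" .
      have T_powr: "(T \<rho>) powr s * T \<rho> = (T \<rho>) powr (1 + s)"
        using T_nonneg[of \<rho>] by (simp add: powr_add powr_one mult.commute)
      have L\<delta>: "(L / \<delta>)\<^sup>2 = L\<^sup>2 * \<delta> powr (-2)"
        using \<delta> by (simp add: powr_minus power_mult_distrib power_inverse divide_inverse)
      have \<delta>m: "\<delta> powr (-2) * \<delta> powr (- real DIM('a) * s) = \<delta> powr (-m)"
        by (simp add: powr_add[symmetric] m_def)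
      have "(L / \<delta>)\<^sup>2 * ?Q = L\<^sup>2 * a powr s / c *
          (\<delta> powr (-2) * \<delta> powr (- real DIM('a) * s)) * (T \<rho>) powr (1 + s)"
        unfolding Q T_powr L\<delta> by (simp add: divide_inverse mult_ac)
      then have LQ: "(L / \<delta>)\<^sup>2 * ?Q = K * \<delta> powr (-m) * (T \<rho>) powr (1 + s)"
        by (simp only: \<delta>m K_def)
      have "(L / \<delta>)\<^sup>2 * (16 * (\<tau> * \<delta>)\<^sup>2 * T \<rho>) = 16 * (L\<^sup>2 * \<tau>\<^sup>2) * T \<rho>"
        using \<delta> by (simp add: power_mult_distrib power_divide)
      also have "\<dots> \<le> 16 * (1 / 64) * T \<rho>"
        using L\<tau> T_nonneg by (intro mult_right_mono mult_left_mono) auto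
      finally have first: "(L / \<delta>)\<^sup>2 * (16 * (\<tau> * \<delta>)\<^sup>2 * T \<rho>) \<le> 1 / 4 * T \<rho>" by simp
      have "2 * T (\<rho> + \<delta> + \<delta>) \<le> T (\<rho> + \<delta>) + 2 * (L / \<delta>)\<^sup>2 * ?U"
        using \<rho> \<delta> by (intro caccioppoli) auto
      also have "T (\<rho> + \<delta>) \<le> T \<rho>" using \<delta> by (intro T_antimono) simp
      also have "2 * (L / \<delta>)\<^sup>2 * ?U \<le> 2 * (L / \<delta>)\<^sup>2 * (16 * (\<tau> * \<delta>)\<^sup>2 * T \<rho> + ?Q)"
        using U by (intro mult_left_mono) auto
      also have "\<dots> = 2 * ((L / \<delta>)\<^sup>2 * (16 * (\<tau> * \<delta>)\<^sup>2 * T \<rho>)) + 2 * ((L / \<delta>)\<^sup>2 * ?Q)"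
        by (simp only: distrib_left mult.assoc)
      finally have "2 * T (\<rho> + \<delta> + \<delta>) \<le> T \<rho> + 2 * (1 / 4 * T \<rho>) + 2 * (K * \<delta> powr (-m) * (T \<rho>) powr (1 + s))"
        unfolding LQ using first by linarith
      then show ?thesis by (simp add: algebra_simps)
    qed
    have "K \<ge> 0" "m > 0" using c s by (auto simp: K_def m_def intro!: add_pos_nonneg)
    note Km = this
    obtain R where R: "T R = 0"
      by (rule decay_iteration[of \<rho>f T K m s]) (use T_antimono T_nonneg Km s(2) decay in blast)+
    have "AE x in lborel. indicator (E R) x * e x = 0"
      using R int_Ee[of R] e_nonneg unfolding T_def
      by (subst (asm) integral_nonneg_eq_0_iff_AE) auto
    then have "AE x in lborel. norm x > R \<longrightarrow> u x = 0"
      using ueq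
    proof eventually_elim
      case (elim x)
      show ?case
      proof
        assume "norm x > R"
        then have "(norm (g' x))\<^sup>2 + c * \<bar>u' x\<bar> powr r = 0" using elim(1) by (simp add: E_def e_def)
        moreover have "c * \<bar>u' x\<bar> powr r \<ge> 0" using c by simp
        ultimately have "c * \<bar>u' x\<bar> powr r = 0" using zero_le_power2[of "norm (g' x)"] by linarith
        then show "u x = 0" using c elim(2) by simp
      qed
    qed
    then show ?thesis by (intro compact_supportI[of R]) (simp only: AE_lebesgue_iff)
  qed
qed

end
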